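(* Assume Martin's Axiom ($\mathrm{MA}$). Then there exists a countable Boolean (Hausdorff) topological group $G$ which is a $\kappa$-Fréchet–Urysohn space but is not a $k_{\mathbb{R}}$-space.
   Context: The ambient set theory is ZFC, with Martin's Axiom as an additional hypothesis. All topological groups are assumed Hausdorff (hence Tychonoff). A group is Boolean if every element $g$ satisfies $g^2=e$, where $e$ is the identity. $\omega=\{0,1,2,\dots\}$. A Tychonoff space $X$ is called $\kappa$-Fréchet–Urysohn if, for any open set $U\subseteq X$ and each point $x\in\overline{U}$, there exists a sequence $\{x_n\}_{n\in\omega}\subseteq U$ that converges to $x$. A function $f:X\to\mathbb{R}$ on a Tychonoff space $X$ is called $k$-continuous if the restriction of $f$ to each compact subset of $X$ is continuous. A Tychonoff space $X$ is a $k_{\mathbb{R}}$-space if every $k$-continuous function $f:X\to\mathbb{R}$ is continuous. *)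

theory Defs
  imports "HOL-Analysis.Analysis" "HOL-Algebra.Group"
begin

section \<open>Martin's Axiom\<close>

text \<open>Forcing convention: \<open>(p, q) \<in> r\<close> reads \<open>p \<le> q\<close>, i.e. \<open>p\<close> is the stronger condition;
  \<open>P\<close> is the underlying set.\<close>

definition compatible_in :: "'a set \<Rightarrow> 'a rel \<Rightarrow> 'a \<Rightarrow> 'a \<Rightarrow> bool" where
  "compatible_in P r p q \<longleftrightarrow> (\<exists>s\<in>P. (s, p) \<in> r \<and> (s, q) \<in> r)"

definition ccc_on :: "'a set \<Rightarrow> 'a rel \<Rightarrow> bool" where
  "ccc_on P r \<longleftrightarrow>
     (\<forall>A\<subseteq>P. (\<forall>p\<in>A. \<forall>q\<in>A. p \<noteq> q \<longrightarrow> \<not> compatible_in P r p q) \<longrightarrow> countable A)"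

definition order_dense_on :: "'a set \<Rightarrow> 'a rel \<Rightarrow> 'a set \<Rightarrow> bool" where
  "order_dense_on P r D \<longleftrightarrow> D \<subseteq> P \<and> (\<forall>p\<in>P. \<exists>d\<in>D. (d, p) \<in> r)"

definition order_filter_on :: "'a set \<Rightarrow> 'a rel \<Rightarrow> 'a set \<Rightarrow> bool" where
  "order_filter_on P r F \<longleftrightarrow>
     F \<subseteq> P \<and> F \<noteq> {} \<and>
     (\<forall>p\<in>F. \<forall>q\<in>P. (p, q) \<in> r \<longrightarrow> q \<in> F) \<and>
     (\<forall>p\<in>F. \<forall>q\<in>F. \<exists>s\<in>F. (s, p) \<in> r \<and> (s, q) \<in> r)"

text \<open>HOL cannot quantify over all types inside a formula, so the axiom is stated for the posets
  whose underlying set lies in a given type. The instance at type \<^typ>\<open>real\<close> already yields all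
  other instances, see \<open>martins_axiom_real_imp_all\<close> below.\<close>

definition martins_axiom :: "'a itself \<Rightarrow> bool" where
  "martins_axiom (_ :: 'a itself) \<longleftrightarrow>
     (\<forall>(P :: 'a set) r \<D>.
        P \<noteq> {} \<and> partial_order_on P r \<and> ccc_on P r \<and>
        (\<forall>D\<in>\<D>. order_dense_on P r D) \<and> \<D> \<prec> (UNIV :: real set) \<longrightarrow>
        (\<exists>F. order_filter_on P r F \<and> (\<forall>D\<in>\<D>. F \<inter> D \<noteq> {})))"

lemma closure_lepoll_real:
  fixes f :: "'i \<Rightarrow> 'a \<Rightarrow> 'a" and g :: "'a \<Rightarrow> 'a \<Rightarrow> 'a"
  assumes I: "I \<lesssim> (UNIV :: real set)" and p0: "p0 \<in> P"
    and f: "\<And>i p. i \<in> I \<Longrightarrow> p \<in> P \<Longrightarrow> f i p \<in> P"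
    and g: "\<And>p q. p \<in> P \<Longrightarrow> q \<in> P \<Longrightarrow> g p q \<in> P"
  obtains Q where "p0 \<in> Q" "Q \<subseteq> P" "Q \<lesssim> (UNIV :: real set)"
    "\<And>i p. i \<in> I \<Longrightarrow> p \<in> Q \<Longrightarrow> f i p \<in> Q" "\<And>p q. p \<in> Q \<Longrightarrow> q \<in> Q \<Longrightarrow> g p q \<in> Q"
proof -
  include cardinal_syntax
  let ?R = "UNIV :: real set"
  define S where "S = rec_nat {p0} (\<lambda>_ A. A \<union> case_prod f ` (I \<times> A) \<union> case_prod g ` (A \<times> A))"
  have S0: "S 0 = {p0}"
    and SS: "\<And>n. S (Suc n) = S n \<union> case_prod f ` (I \<times> S n) \<union> case_prod g ` (S n \<times> S n)"
    by (auto simp: S_def)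
  have infR: "infinite ?R" by (rule infinite_UNIV_char_0)
  have IR: "|I| \<le>o |?R|" using I unfolding lepoll_def card_of_ordLeq .
  have times: "|A \<times> B| \<le>o |?R|" if "|A| \<le>o |?R|" "|B| \<le>o |?R|" for A :: "'x set" and B :: "'y set"
    using that by (intro card_of_Sigma_ordLeq_infinite[OF infR]) auto
  have un: "|A \<union> B| \<le>o |?R|" if "|A| \<le>o |?R|" "|B| \<le>o |?R|" for A B :: "'x set"
    using that infR
    by (intro card_of_Un_ordLeq_infinite_Field card_of_Card_order) (auto simp only: Field_card_of)
  have im: "|h ` A| \<le>o |?R|" if "|A| \<le>o |?R|" for h :: "'x \<Rightarrow> 'y" and A
    using card_of_image ordLeq_transitive that by blast
  have Sn: "|S n| \<le>o |?R|" for n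
  proof (induction n)
    case 0
    show ?case
      unfolding S0 by (rule card_of_ordLeqI[of "\<lambda>_. 0"]) auto
  next
    case (Suc n)
    show ?case unfolding SS
      by (intro un Suc im times IR)
  qed
  have SP: "S n \<subseteq> P" for n
    by (induction n) (auto simp: S0 SS p0 f g subset_iff)
  have mono: "S m \<subseteq> S n" if "m \<le> n" for m n
    using that by (rule lift_Suc_mono_le[rotated]) (auto simp: SS)
  define Q where "Q = (\<Union>n. S n)"
  have natR: "|UNIV :: nat set| \<le>o |?R|"
    using infR infinite_iff_card_of_nat by blast
  have "|Q| \<le>o |?R|"
    unfolding Q_def using Sn by (intro card_of_UNION_ordLeq_infinite[OF infR natR]) auto
  then have QR: "Q \<lesssim> ?R"
    unfolding lepoll_def card_of_ordLeq .
  show ?thesis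
  proof (rule that[of Q])
    show "p0 \<in> Q" using S0 by (auto simp: Q_def)
    show "Q \<subseteq> P" using SP by (auto simp: Q_def)
    show "Q \<lesssim> ?R" by (rule QR)
    show "f i p \<in> Q" if ip: "i \<in> I" "p \<in> Q" for i p
    proof -
      from ip obtain n where "p \<in> S n" by (auto simp: Q_def)
      then have "f i p \<in> S (Suc n)" using ip by (force simp: SS)
      then show ?thesis by (auto simp: Q_def)
    qed
    show "g p q \<in> Q" if pq: "p \<in> Q" "q \<in> Q" for p q
    proof -
      from pq obtain m n where "p \<in> S m" "q \<in> S n" by (auto simp: Q_def)
      then have "p \<in> S (max m n)" "q \<in> S (max m n)"
        using mono[of m "max m n"] mono[of n "max m n"] by auto
      then have "g p q \<in> S (Suc (max m n))" by (force simp: SS)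
      then show ?thesis unfolding Q_def by blast
    qed
  qed
qed

theorem martins_axiom_real_imp_all:
  assumes MA: "martins_axiom TYPE(real)"
  shows "martins_axiom TYPE('a)"
  unfolding martins_axiom_def
proof (intro allI impI)
  fix P :: "'a set" and r \<D>
  assume "P \<noteq> {} \<and> partial_order_on P r \<and> ccc_on P r \<and>
    (\<forall>D\<in>\<D>. order_dense_on P r D) \<and> \<D> \<prec> (UNIV :: real set)"
  then have ne: "P \<noteq> {}" and po: "partial_order_on P r" and ccc: "ccc_on P r"
    and dense: "\<And>D. D \<in> \<D> \<Longrightarrow> order_dense_on P r D" and small: "\<D> \<prec> (UNIV :: real set)"
    by auto
  have refl: "\<And>p. p \<in> P \<Longrightarrow> (p, p) \<in> r" and tr: "\<And>x y z. (x, y) \<in> r \<Longrightarrow> (y, z) \<in> r \<Longrightarrow> (x, z) \<in> r"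
    and anti: "\<And>x y. (x, y) \<in> r \<Longrightarrow> (y, x) \<in> r \<Longrightarrow> x = y"
    using po unfolding partial_order_on_def preorder_on_def
    by (auto simp: refl_on_def dest: transD antisymD)
  obtain p0 where p0: "p0 \<in> P" using ne by blast
  define f where "f D p = (SOME d. d \<in> D \<and> (d, p) \<in> r)" for D p
  have f: "f D p \<in> D \<and> (f D p, p) \<in> r" if "D \<in> \<D>" "p \<in> P" for D p
    unfolding f_def by (rule someI_ex) (use dense[OF that(1)] that(2) in \<open>auto simp: order_dense_on_def\<close>)
  define g where
    "g p q = (if compatible_in P r p q then SOME s. s \<in> P \<and> (s, p) \<in> r \<and> (s, q) \<in> r else p0)" for p q
  have g: "g p q \<in> P \<and> (g p q, p) \<in> r \<and> (g p q, q) \<in> r" if "compatible_in P r p q" for p q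
    unfolding g_def using that
    by (simp, intro someI_ex[where P = "\<lambda>s. s \<in> P \<and> (s, p) \<in> r \<and> (s, q) \<in> r"])
      (auto simp: compatible_in_def)
  have gP: "g p q \<in> P" for p q
    using g[of p q] p0 by (cases "compatible_in P r p q") (auto simp: g_def)
  have fP: "f D p \<in> P" if "D \<in> \<D>" "p \<in> P" for D p
    using f[OF that] dense[OF that(1)] by (auto simp: order_dense_on_def)
  obtain Q where p0Q: "p0 \<in> Q" and QP: "Q \<subseteq> P" and QR: "Q \<lesssim> (UNIV :: real set)"
    and fQ: "\<And>D p. D \<in> \<D> \<Longrightarrow> p \<in> Q \<Longrightarrow> f D p \<in> Q" and gQ: "\<And>p q. p \<in> Q \<Longrightarrow> q \<in> Q \<Longrightarrow> g p q \<in> Q"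
    using closure_lepoll_real[of \<D> p0 P f g] small p0 fP gP lesspoll_imp_lepoll by metis
  obtain h :: "'a \<Rightarrow> real" where h: "inj_on h Q"
    using QR by (auto simp: lepoll_def)
  have hD: "p = q" if "h p = h q" "p \<in> Q" "q \<in> Q" for p q
    using inj_onD[OF h that] .
  define P' where "P' = h ` Q"
  define r' where "r' = {(h p, h q) | p q. p \<in> Q \<and> q \<in> Q \<and> (p, q) \<in> r}"
  have r'I: "(h p, h q) \<in> r' \<longleftrightarrow> (p, q) \<in> r" if "p \<in> Q" "q \<in> Q" for p q
    using that unfolding r'_def by (auto dest: hD)
  define \<D>' where "\<D>' = (\<lambda>D. h ` (D \<inter> Q)) ` \<D>"
  have "P' \<noteq> {}" using p0Q by (auto simp: P'_def)
  moreover have "partial_order_on P' r'"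
    unfolding partial_order_on_def preorder_on_def
  proof (intro conjI)
    show "r' \<subseteq> P' \<times> P'" by (auto simp: r'_def P'_def)
    show "refl_on P' r'" using refl QP by (auto simp: refl_on_def P'_def r'I subset_iff)
    show "trans r'"
      unfolding trans_def r'_def by clarsimp (metis hD tr)
    show "antisym r'"
      unfolding antisym_def r'_def by clarsimp (metis hD anti)
  qed
  moreover have "ccc_on P' r'"
    unfolding ccc_on_def
  proof (intro allI impI)
    fix A assume A: "A \<subseteq> P'" and inc: "\<forall>p\<in>A. \<forall>q\<in>A. p \<noteq> q \<longrightarrow> \<not> compatible_in P' r' p q"
    define B where "B = {p \<in> Q. h p \<in> A}"
    have "\<not> compatible_in P r p q" if "p \<in> B" "q \<in> B" "p \<noteq> q" for p q
    proof
      assume c: "compatible_in P r p q"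
      have pq: "p \<in> Q" "q \<in> Q" "h p \<in> A" "h q \<in> A" using that by (auto simp: B_def)
      have "compatible_in P' r' (h p) (h q)"
        unfolding compatible_in_def P'_def using g[OF c] gQ[of p q] pq by (auto simp: r'I)
      moreover have "h p \<noteq> h q" using hD pq that by blast
      ultimately show False using inc pq by blast
    qed
    then have "\<forall>p\<in>B. \<forall>q\<in>B. p \<noteq> q \<longrightarrow> \<not> compatible_in P r p q" by simp
    moreover have "B \<subseteq> P" using QP by (auto simp: B_def)
    ultimately have "countable B" using ccc[unfolded ccc_on_def, rule_format, of B] by simp
    moreover have "A = h ` B" using A by (auto simp: B_def P'_def)
    ultimately show "countable A" by simp
  qed
  moreover have "\<forall>D\<in>\<D>'. order_dense_on P' r' D"
  proof
    fix D' assume "D' \<in> \<D>'"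
    then obtain D where D: "D \<in> \<D>" "D' = h ` (D \<inter> Q)" by (auto simp: \<D>'_def)
    have "\<exists>d\<in>D \<inter> Q. (d, p) \<in> r" if "p \<in> Q" for p
      using f[OF D(1)] fQ[OF D(1)] that QP by blast
    then show "order_dense_on P' r' D'"
      unfolding order_dense_on_def D(2) P'_def by (auto simp: r'I)
  qed
  moreover have "\<D>' \<prec> (UNIV :: real set)"
    unfolding \<D>'_def using image_lepoll lesspoll_trans1 small by blast
  ultimately obtain F' where F': "order_filter_on P' r' F'" and meet: "\<forall>D\<in>\<D>'. F' \<inter> D \<noteq> {}"
    using MA[unfolded martins_axiom_def, rule_format, of P' r' \<D>'] by auto
  define F where "F = {p \<in> P. \<exists>q\<in>Q. h q \<in> F' \<and> (q, p) \<in> r}"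
  have F'Q: "\<exists>q\<in>Q. x = h q" if "x \<in> F'" for x
    using F' that by (auto simp: order_filter_on_def P'_def)
  have "order_filter_on P r F"
    unfolding order_filter_on_def
  proof (intro conjI ballI impI)
    show "F \<subseteq> P" by (auto simp: F_def)
    obtain x where "x \<in> F'" using F' by (auto simp: order_filter_on_def)
    with F'Q obtain q where "q \<in> Q" "h q \<in> F'" by blast
    then show "F \<noteq> {}" using refl QP by (auto simp: F_def)
    show "q \<in> F" if "p \<in> F" "q \<in> P" "(p, q) \<in> r" for p q
      using that tr by (auto simp: F_def)
    show "\<exists>s\<in>F. (s, p) \<in> r \<and> (s, q) \<in> r" if "p \<in> F" "q \<in> F" for p q
    proof -
      obtain a b where ab: "a \<in> Q" "h a \<in> F'" "(a, p) \<in> r" "b \<in> Q" "h b \<in> F'" "(b, q) \<in> r"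
        using \<open>p \<in> F\<close> \<open>q \<in> F\<close> by (auto simp: F_def)
      obtain x where "x \<in> F'" "(x, h a) \<in> r'" "(x, h b) \<in> r'"
        using F' ab unfolding order_filter_on_def by blast
      then obtain s where s: "s \<in> Q" "h s \<in> F'" "(s, a) \<in> r" "(s, b) \<in> r"
        using F'Q ab r'I by metis
      then have "s \<in> F" using refl QP by (auto simp: F_def)
      then show ?thesis using s ab tr by blast
    qed
  qed
  moreover have "\<forall>D\<in>\<D>. F \<inter> D \<noteq> {}"
  proof
    fix D assume "D \<in> \<D>"
    then have "F' \<inter> h ` (D \<inter> Q) \<noteq> {}" using meet by (auto simp: \<D>'_def)
    then show "F \<inter> D \<noteq> {}" using refl QP by (auto simp: F_def)
  qed
  ultimately show "\<exists>F. order_filter_on P r F \<and> (\<forall>D\<in>\<D>. F \<inter> D \<noteq> {})" by blast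
qed

section \<open>Topological groups\<close>

definition topological_group :: "('a, 'b) monoid_scheme \<Rightarrow> 'a topology \<Rightarrow> bool" where
  "topological_group G X \<longleftrightarrow>
     group G \<and> topspace X = carrier G \<and>
     continuous_map (prod_topology X X) X (\<lambda>(x, y). x \<otimes>\<^bsub>G\<^esub> y) \<and>
     continuous_map X X (\<lambda>x. inv\<^bsub>G\<^esub> x)"

definition boolean_group :: "('a, 'b) monoid_scheme \<Rightarrow> bool" where
  "boolean_group G \<longleftrightarrow> group G \<and> (\<forall>g\<in>carrier G. g \<otimes>\<^bsub>G\<^esub> g = \<one>\<^bsub>G\<^esub>)"

section \<open>Classes of Tychonoff spaces\<close>

definition tychonoff_space :: "'a topology \<Rightarrow> bool" where
  "tychonoff_space X \<longleftrightarrow> completely_regular_space X \<and> Hausdorff_space X"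

definition kappa_frechet_urysohn :: "'a topology \<Rightarrow> bool" where
  "kappa_frechet_urysohn X \<longleftrightarrow>
     tychonoff_space X \<and>
     (\<forall>U x. openin X U \<and> x \<in> X closure_of U \<longrightarrow>
        (\<exists>s :: nat \<Rightarrow> 'a. range s \<subseteq> U \<and> limitin X s x sequentially))"

definition k_continuous :: "'a topology \<Rightarrow> ('a \<Rightarrow> real) \<Rightarrow> bool" where
  "k_continuous X f \<longleftrightarrow>
     (\<forall>K. compactin X K \<longrightarrow> continuous_map (subtopology X K) euclideanreal f)"

definition kR_space :: "'a topology \<Rightarrow> bool" where
  "kR_space X \<longleftrightarrow>
     tychonoff_space X \<and> (\<forall>f. k_continuous X f \<longrightarrow> continuous_map X euclideanreal f)"

end

theory Submission
  imports Defs
begin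

text \<open>
  Let \<open>H\<close> be the countable Boolean group of functions from sets of natural numbers to \<open>bool\<close>
  that depend on finitely many coordinates only. Under Martin's Axiom, a Galvin--Miller recursion
  along a well-order of the reals yields a tower \<open>x\<^sub>a\<close>, decreasing modulo finite sets, such
  that \<open>H\<close> with pointwise convergence on \<open>X = {x\<^sub>a} \<union> {finite sets}\<close> is Frechet--Urysohn:
  stage \<open>a\<close> treats the \<open>a\<close>-th subset of \<open>H\<close>, and a convergent sequence found there keeps
  converging at every later point, because it converges at every \<open>y\<close> almost contained in
  \<open>x\<^sub>a\<close>.
  There are only continuum many sequences in \<open>H\<close>, so diagonalising against them along
  the \<open>x\<^sub>a\<close> gives a function \<open>g\<close> on \<open>X\<close> that is no limit of a sequence in \<open>H\<close>. In
  \<open>G = H \<union> (g + H)\<close>, the dense Frechet--Urysohn subgroup \<open>H\<close> provides the sequences for the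
  \<open>\<kappa>\<close>-Frechet--Urysohn property. The indicator of \<open>H\<close> is sequentially continuous, hence
  continuous on the compact subsets (which are sequential since \<open>G\<close> is countable), but it is not
  continuous since \<open>H\<close> is dense.
\<close>

section \<open>Consequences of Martin's Axiom\<close>

lemma lesspoll_iff_ordLess: "A \<prec> B \<longleftrightarrow> (card_of A, card_of B) \<in> ordLess"
  unfolding lesspoll_def lepoll_def eqpoll_def
  by (metis card_of_ordIso card_of_ordLeq ordLeq_iff_ordLess_or_ordIso ordLess_imp_ordLeq
      not_ordLess_ordIso)

lemma countable_imp_lesspoll_real:
  assumes "countable A"
  shows "A \<prec> (UNIV :: real set)"
proof -
  have "\<not> (UNIV :: real set) \<lesssim> A"
    using assms countable_lepoll uncountable_UNIV_real by blast
  then have "\<not> (card_of (UNIV :: real set), card_of A) \<in> ordLeq"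
    by (simp add: lepoll_def card_of_ordLeq)
  then show ?thesis
    unfolding lesspoll_iff_ordLess by (meson card_of_Well_order not_ordLeq_iff_ordLess)
qed

lemma Un_lesspoll_real:
  assumes "A \<prec> (UNIV :: real set)" "B \<prec> (UNIV :: real set)"
  shows "A \<union> B \<prec> (UNIV :: real set)"
  using assms card_of_Un_ordLess_infinite[OF infinite_UNIV_char_0]
  by (simp add: lesspoll_iff_ordLess)

text \<open>A condition \<open>(t, F)\<close> is a finite stem \<open>t\<close> of the sequence with
  finitely many promises \<open>F\<close>: later entries must lie in all members of
  \<open>F\<close>. There are countably many stems, and conditions sharing a stem are compatible,
  which gives the countable chain condition.\<close>

lemma MA_eventually_nat:
  fixes \<A> :: "nat set set"
  assumes MA: "martins_axiom TYPE(real)"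
    and small: "\<A> \<prec> (UNIV :: real set)"
    and fip: "\<And>F. finite F \<Longrightarrow> F \<subseteq> \<A> \<Longrightarrow> \<Inter>F \<noteq> {}"
  shows "\<exists>s. \<forall>A\<in>\<A>. eventually (\<lambda>n. s n \<in> A) sequentially"
proof -
  define P where "P = {(t :: nat list, F). finite F \<and> F \<subseteq> \<A>}"
  define r where "r = {((t', F'), (t, F)). finite F \<and> F \<subseteq> \<A> \<and> finite F' \<and> F' \<subseteq> \<A> \<and> F \<subseteq> F' \<and>
      (\<exists>w. t' = t @ w \<and> set w \<subseteq> \<Inter>F)}"
  \<comment> \<open>The first family of dense sets puts every \<open>A\<close> among the promises,
    the second makes the generic sequence infinite.\<close>
  define \<D> where "\<D> = (\<lambda>A. {(t, F) \<in> P. A \<in> F}) ` \<A> \<union> range (\<lambda>n. {(t, F) \<in> P. n < length t})"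
  have "([], {}) \<in> P" by (auto simp: P_def)
  then have "P \<noteq> {}" by blast
  moreover have "partial_order_on P r"
    unfolding partial_order_on_def preorder_on_def
  proof (intro conjI)
    show "r \<subseteq> P \<times> P" by (auto simp: r_def P_def)
    show "refl_on P r" by (auto simp: refl_on_def r_def P_def)
    show "trans r"
    proof (rule transI)
      fix p q s assume pqs: "(p, q) \<in> r" "(q, s) \<in> r"
      then obtain w v where "fst p = fst q @ w" "set w \<subseteq> \<Inter>(snd q)"
        "fst q = fst s @ v" "set v \<subseteq> \<Inter>(snd s)" "snd s \<subseteq> snd q" by (auto simp: r_def)
      then have "fst p = fst s @ (v @ w)" "set (v @ w) \<subseteq> \<Inter>(snd s)" by auto
      then have "\<exists>w. fst p = fst s @ w \<and> set w \<subseteq> \<Inter>(snd s)" by blast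
      then show "(p, s) \<in> r" using pqs unfolding r_def by (auto simp: case_prod_unfold)
    qed
    show "antisym r" unfolding antisym_def r_def by auto
  qed
  moreover have "ccc_on P r"
    unfolding ccc_on_def
  proof (intro allI impI)
    fix Q assume Q: "Q \<subseteq> P" and inc: "\<forall>p\<in>Q. \<forall>q\<in>Q. p \<noteq> q \<longrightarrow> \<not> compatible_in P r p q"
    have "compatible_in P r p q" if "p \<in> P" "q \<in> P" "fst p = fst q" for p q
      unfolding compatible_in_def
      by (rule bexI[of _ "(fst p, snd p \<union> snd q)"]) (use that in \<open>auto simp: P_def r_def\<close>)
    then have "inj_on fst Q" using Q inc unfolding inj_on_def by blast
    then show "countable Q" by (rule countable_image_inj_on[rotated]) simp
  qed
  moreover have "\<forall>D\<in>\<D>. order_dense_on P r D"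
  proof
    fix D assume "D \<in> \<D>"
    then consider A where "A \<in> \<A>" "D = {(t, F) \<in> P. A \<in> F}"
      | n where "D = {(t, F) \<in> P. n < length t}"
      unfolding \<D>_def by blast
    then show "order_dense_on P r D"
    proof cases
      case 1
      have "\<exists>d\<in>D. (d, (t, F)) \<in> r" if "(t, F) \<in> P" for t F
        by (rule bexI[of _ "(t, insert A F)"]) (use that 1 in \<open>auto simp: P_def r_def\<close>)
      then show ?thesis unfolding order_dense_on_def using 1 by auto
    next
      case 2
      have "\<exists>d\<in>D. (d, (t, F)) \<in> r" if tF: "(t, F) \<in> P" for t F
      proof -
        \<comment> \<open>The finite intersection property enters here: a point allowed by all
          promises, repeated, makes the stem as long as required.\<close>
        obtain a where "a \<in> \<Inter>F" using fip[of F] tF by (auto simp: P_def)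
        then show ?thesis
          by (intro bexI[of _ "(t @ replicate (Suc n) a, F)"]) (use tF 2 in \<open>auto simp: P_def r_def\<close>)
      qed
      then show ?thesis unfolding order_dense_on_def using 2 by auto
    qed
  qed
  moreover have "\<D> \<prec> (UNIV :: real set)"
    unfolding \<D>_def
    by (intro Un_lesspoll_real countable_imp_lesspoll_real lesspoll_trans1[OF image_lepoll small]) auto
  \<comment> \<open>The conditions are not reals, so the axiom is first carried over to their
    type.\<close>
  ultimately have "\<exists>\<Phi>. order_filter_on P r \<Phi> \<and> (\<forall>D\<in>\<D>. \<Phi> \<inter> D \<noteq> {})"
    by (intro martins_axiom_real_imp_all[OF MA, unfolded martins_axiom_def, rule_format] conjI)
  then obtain \<Phi> where \<Phi>: "order_filter_on P r \<Phi>" and meet: "\<And>D. D \<in> \<D> \<Longrightarrow> \<Phi> \<inter> D \<noteq> {}"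
    by blast
  have dir: "\<And>p q. p \<in> \<Phi> \<Longrightarrow> q \<in> \<Phi> \<Longrightarrow> \<exists>z\<in>\<Phi>. (z, p) \<in> r \<and> (z, q) \<in> r"
    using \<Phi> unfolding order_filter_on_def by auto
  have "\<forall>n. \<exists>p. p \<in> \<Phi> \<and> n < length (fst p)"
  proof
    fix n
    have "\<Phi> \<inter> {(t, F) \<in> P. n < length t} \<noteq> {}" by (rule meet) (auto simp: \<D>_def)
    then show "\<exists>p. p \<in> \<Phi> \<and> n < length (fst p)" by auto
  qed
  then obtain c where c: "\<And>n. c n \<in> \<Phi>" "\<And>n. n < length (fst (c n))" by metis
  \<comment> \<open>Conditions in the filter have common extensions, so their stems agree where both
    are defined (\<open>coh\<close>); hence \<open>s n\<close> does not depend on the choice of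
    \<open>c n\<close>.\<close>
  define s where "s n = fst (c n) ! n" for n
  have coh: "fst p ! n = s n" if p: "p \<in> \<Phi>" "n < length (fst p)" for p n
  proof -
    obtain z where "(z, p) \<in> r" "(z, c n) \<in> r" using dir[OF p(1) c(1)] by blast
    then obtain w v where "fst z = fst p @ w" "fst z = fst (c n) @ v" by (auto simp: r_def)
    then show ?thesis using p(2) c(2)[of n] unfolding s_def by (metis nth_append)
  qed
  have "eventually (\<lambda>n. s n \<in> A) sequentially" if A: "A \<in> \<A>" for A
  proof -
    have "\<Phi> \<inter> {(t, F) \<in> P. A \<in> F} \<noteq> {}" by (rule meet) (use A in \<open>auto simp: \<D>_def\<close>)
    then obtain t F where tF: "(t, F) \<in> \<Phi>" "A \<in> F" by auto
    have "s n \<in> A" if n: "length t \<le> n" for n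
    proof -
      \<comment> \<open>A common extension of \<open>(t, F)\<close> and \<open>c n\<close> has an
        entry at position \<open>n\<close>, added after \<open>t\<close> and therefore under the
        promise \<open>A\<close>.\<close>
      obtain z where z: "z \<in> \<Phi>" "(z, (t, F)) \<in> r" "(z, c n) \<in> r" using dir[OF tF(1) c(1)] by blast
      from z(3) c(2)[of n] have len: "n < length (fst z)" by (auto simp: r_def)
      from z(2) obtain w where w: "fst z = t @ w" "set w \<subseteq> \<Inter>F" by (auto simp: r_def)
      have "fst z ! n = w ! (n - length t)" "n - length t < length w"
        using w(1) n len by (auto simp: nth_append)
      then have "fst z ! n \<in> A" using w(2) tF(2) nth_mem by fastforce
      then show ?thesis using coh[OF z(1) len] by simp
    qed
    then show ?thesis by (auto simp: eventually_sequentially)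
  qed
  then show ?thesis by blast
qed

text \<open>An enumeration of \<open>C\<close> reduces this to natural numbers. The index set
  \<open>I\<close> allows the requirements to be evaluations of functions at points.\<close>

lemma MA_eventually_countable:
  assumes MA: "martins_axiom TYPE(real)" and C: "countable C"
    and small: "I \<prec> (UNIV :: real set)"
    and fip: "\<And>F. finite F \<Longrightarrow> F \<subseteq> I \<Longrightarrow> \<exists>c\<in>C. \<forall>i\<in>F. R i c"
  shows "\<exists>s :: nat \<Rightarrow> 'a. range s \<subseteq> C \<and> (\<forall>i\<in>I. eventually (\<lambda>n. R i (s n)) sequentially)"
proof -
  have ne: "C \<noteq> {}" using fip[of "{}"] by auto
  let ?e = "from_nat_into C"
  define \<A> where "\<A> = (\<lambda>i. {n. R i (?e n)}) ` I"
  have "\<A> \<prec> (UNIV :: real set)"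
    unfolding \<A>_def by (rule lesspoll_trans1[OF image_lepoll small])
  moreover have "\<Inter>F \<noteq> {}" if F: "finite F" "F \<subseteq> \<A>" for F
  proof -
    obtain J where J: "J \<subseteq> I" "finite J" "F = (\<lambda>i. {n. R i (?e n)}) ` J"
      using finite_subset_image[OF F[unfolded \<A>_def]] by blast
    obtain c where c: "c \<in> C" "\<forall>i\<in>J. R i c" using fip[OF J(2,1)] by blast
    obtain n where "?e n = c" using from_nat_into_surj[OF C c(1)] by blast
    then have "n \<in> \<Inter>F" using c J(3) by auto
    then show ?thesis by blast
  qed
  ultimately obtain s where s: "\<forall>A\<in>\<A>. eventually (\<lambda>n. s n \<in> A) sequentially"
    using MA_eventually_nat[OF MA, of \<A>] by blast
  show ?thesis
  proof (intro exI[of _ "?e \<circ> s"] conjI ballI)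
    show "range (?e \<circ> s) \<subseteq> C" using from_nat_into[OF ne] by auto
    show "eventually (\<lambda>n. R i ((?e \<circ> s) n)) sequentially" if "i \<in> I" for i
      using s that by (auto simp: \<A>_def)
  qed
qed

section \<open>Inclusion modulo finite sets and pseudo-intersections\<close>

definition almost_subset :: "nat set \<Rightarrow> nat set \<Rightarrow> bool" where
  "almost_subset x y \<longleftrightarrow> finite (x - y)"

lemma almost_subset_refl: "almost_subset x x"
  by (simp add: almost_subset_def)

lemma almost_subset_trans:
  assumes "almost_subset x y" "almost_subset y z"
  shows "almost_subset x z"
proof -
  have "x - z \<subseteq> (x - y) \<union> (y - z)" by blast
  then show ?thesis using assms unfolding almost_subset_def
    by (meson finite_UnI finite_subset)
qed

lemma finite_almost_chain_least:
  assumes "finite F" "F \<noteq> {}" "\<And>x y. x \<in> F \<Longrightarrow> y \<in> F \<Longrightarrow> almost_subset x y \<or> almost_subset y x"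
  shows "\<exists>x\<in>F. \<forall>y\<in>F. almost_subset x y"
  using assms
proof (induction F rule: finite_ne_induct)
  case (singleton x)
  then show ?case by (simp add: almost_subset_refl)
next
  case (insert x F)
  then obtain z where z: "z \<in> F" "\<forall>y\<in>F. almost_subset z y" by blast
  have "almost_subset x z \<or> almost_subset z x" using insert.prems z(1) by blast
  then show ?case using z almost_subset_trans almost_subset_refl by blast
qed

text \<open>A finite chain has a least member, which loses only finitely many points on passing to
  the intersection.\<close>

lemma infinite_Inter_almost_chain:
  assumes F: "finite F" "F \<noteq> {}"
    and inf: "\<And>x. x \<in> F \<Longrightarrow> infinite x"
    and ch: "\<And>x y. x \<in> F \<Longrightarrow> y \<in> F \<Longrightarrow> almost_subset x y \<or> almost_subset y x"
  shows "infinite (\<Inter>F)"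
proof
  assume fin: "finite (\<Inter>F)"
  obtain x where x: "x \<in> F" "\<forall>y\<in>F. almost_subset x y"
    using finite_almost_chain_least[OF F ch] by blast
  have "x \<subseteq> \<Inter>F \<union> (\<Union>y\<in>F. x - y)" by blast
  moreover have "finite (\<Union>y\<in>F. x - y)"
    using x(2) F(1) unfolding almost_subset_def by (intro finite_UN_I) blast+
  ultimately show False using inf[OF x(1)] fin by (meson finite_UnI finite_subset)
qed

text \<open>The range of a sequence that is eventually in every member is almost contained in every
  member. Adding the final segments \<open>{k..}\<close> to the family makes this range
  infinite.\<close>

lemma MA_pseudo_intersection:
  fixes \<T> :: "nat set set"
  assumes MA: "martins_axiom TYPE(real)" and small: "\<T> \<prec> (UNIV :: real set)"
    and inf: "\<And>x. x \<in> \<T> \<Longrightarrow> infinite x"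
    and ch: "\<And>x y. x \<in> \<T> \<Longrightarrow> y \<in> \<T> \<Longrightarrow> almost_subset x y \<or> almost_subset y x"
  shows "\<exists>p. infinite p \<and> (\<forall>x\<in>\<T>. almost_subset p x)"
proof -
  define \<A> where "\<A> = \<T> \<union> range (\<lambda>k. {k..})"
  have small': "\<A> \<prec> (UNIV :: real set)"
    unfolding \<A>_def by (intro Un_lesspoll_real small countable_imp_lesspoll_real) auto
  have fip: "\<exists>c\<in>UNIV. \<forall>x\<in>F. c \<in> x" if F: "finite F" "F \<subseteq> \<A>" for F
  proof -
    \<comment> \<open>Inserting \<open>UNIV\<close> lets the chain lemma apply also when
      \<open>F\<close> contains no member of \<open>\<T>\<close>.\<close>
    have inf': "infinite (\<Inter>(insert UNIV (F \<inter> \<T>)))"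
      by (rule infinite_Inter_almost_chain) (use F inf ch in \<open>auto simp: almost_subset_def\<close>)
    obtain K where K: "finite K" "F - \<T> = (\<lambda>k. {k..}) ` K"
      using finite_subset_image[of "F - \<T>" "\<lambda>k. {k..}" UNIV] F by (auto simp: \<A>_def)
    \<comment> \<open>The point lies beyond all starting points in \<open>K\<close>; the inserted
      \<open>0\<close> covers an empty \<open>K\<close>.\<close>
    obtain c where c: "c \<in> \<Inter>(insert UNIV (F \<inter> \<T>))" "Max (insert 0 K) < c"
      using inf'[unfolded infinite_nat_iff_unbounded] by blast
    have "c \<in> x" if "x \<in> F" for x
    proof (cases "x \<in> \<T>")
      case True then show ?thesis using c that by blast
    next
      case False
      then have "x \<in> (\<lambda>k. {k..}) ` K" using that unfolding K(2)[symmetric] by simp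
      then obtain k where k: "k \<in> K" "x = {k..}" by (rule imageE)
      have "k \<le> Max (insert 0 K)" using K(1) k(1) by simp
      then show ?thesis using c(2) k(2) by simp
    qed
    then show ?thesis by blast
  qed
  have "\<exists>s :: nat \<Rightarrow> nat. range s \<subseteq> UNIV \<and> (\<forall>x\<in>\<A>. eventually (\<lambda>n. s n \<in> x) sequentially)"
    by (rule MA_eventually_countable[OF MA _ small']) (auto intro: fip[simplified])
  then obtain s :: "nat \<Rightarrow> nat"
    where s: "\<And>x. x \<in> \<A> \<Longrightarrow> eventually (\<lambda>n. s n \<in> x) sequentially"
    by blast
  show ?thesis
  proof (intro exI[of _ "range s"] conjI ballI)
    show "infinite (range s)"
      unfolding infinite_nat_iff_unbounded
    proof
      fix k
      have "eventually (\<lambda>n. s n \<in> {Suc k..}) sequentially" by (rule s) (auto simp: \<A>_def)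
      then obtain n where "Suc k \<le> s n" by (auto simp: eventually_sequentially)
      then show "\<exists>n>k. n \<in> range s" by (intro exI[of _ "s n"]) auto
    qed
    fix x assume "x \<in> \<T>"
    show "almost_subset (range s) x"
    proof -
      obtain N where "\<forall>n\<ge>N. s n \<in> x"
        using s[of x] \<open>x \<in> \<T>\<close> by (auto simp: \<A>_def eventually_sequentially)
      then have "range s - x \<subseteq> s ` {..<N}" using not_less by blast
      then show ?thesis unfolding almost_subset_def by (meson finite_imageI finite_lessThan finite_subset)
    qed
  qed
qed

section \<open>Cylinder functions and the tower\<close>

text \<open>By compactness of the Cantor space these are its continuous maps to the discrete
  two-point space, that is, the indicators of clopen sets.\<close>

definition cylinder_functions :: "(nat set \<Rightarrow> bool) set" where
  "cylinder_functions = {h. \<exists>m. \<forall>y. h y = h (y \<inter> {..<m})}"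

lemma cylinder_functionsE:
  assumes "h \<in> cylinder_functions"
  obtains m where "\<And>y y'. y \<inter> {..<m} = y' \<inter> {..<m} \<Longrightarrow> h y = h y'"
proof -
  obtain m where m: "\<And>y. h y = h (y \<inter> {..<m})"
    using assms by (auto simp: cylinder_functions_def)
  show ?thesis by (rule that[of m]) (metis m)
qed

lemma cylinder_functionsI:
  assumes "\<And>y y'. y \<inter> {..<m} = y' \<inter> {..<m} \<Longrightarrow> h y = h y'"
  shows "h \<in> cylinder_functions"
proof -
  have "h y = h (y \<inter> {..<m})" for y by (rule assms) (simp add: Int_assoc)
  then show ?thesis unfolding cylinder_functions_def by blast
qed

lemma Int_lessThan_eq_mono:
  assumes "y \<inter> {..<n} = y' \<inter> {..<n}" "m \<le> n"
  shows "y \<inter> {..<m} = y' \<inter> {..<(m :: nat)}"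
proof -
  have "z \<inter> {..<m} = (z \<inter> {..<n}) \<inter> {..<m}" for z using assms(2) by auto
  then show ?thesis using assms(1) by metis
qed

lemma cylinder_functions_xor:
  assumes "h \<in> cylinder_functions" "k \<in> cylinder_functions"
  shows "(\<lambda>y. h y \<noteq> k y) \<in> cylinder_functions"
proof -
  obtain m where m: "\<And>y y'. y \<inter> {..<m} = y' \<inter> {..<m} \<Longrightarrow> h y = h y'"
    using cylinder_functionsE[OF assms(1)] by blast
  obtain n where n: "\<And>y y'. y \<inter> {..<n} = y' \<inter> {..<n} \<Longrightarrow> k y = k y'"
    using cylinder_functionsE[OF assms(2)] by blast
  show ?thesis
  proof (rule cylinder_functionsI[of "max m n"])
    fix y y' :: "nat set" assume eq: "y \<inter> {..<max m n} = y' \<inter> {..<max m n}"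
    have "y \<inter> {..<m} = y' \<inter> {..<m}" "y \<inter> {..<n} = y' \<inter> {..<n}"
      using Int_lessThan_eq_mono[OF eq] by simp_all
    then show "(h y \<noteq> k y) = (h y' \<noteq> k y')" using m[of y y'] n[of y y'] by simp
  qed
qed

lemma cylinder_functions_False: "(\<lambda>_. False) \<in> cylinder_functions"
  by (simp add: cylinder_functions_def)

text \<open>A function depending on coordinates below \<open>m\<close> is determined by
  \<open>m\<close> and the finite family of subsets of \<open>{..<m}\<close> at which it is
  true.\<close>

lemma countable_cylinder_functions: "countable cylinder_functions"
proof -
  let ?K = "{K :: nat set set. finite K \<and> K \<subseteq> Collect finite}"
  have "h \<in> (\<lambda>(m, K) y. y \<inter> {..<m} \<in> K) ` (UNIV \<times> ?K)" if h: "h \<in> cylinder_functions" for h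
  proof -
    obtain m where m: "\<forall>y. h y = h (y \<inter> {..<m})" using h by (auto simp: cylinder_functions_def)
    let ?k = "{s. s \<subseteq> {..<m} \<and> h s}"
    have "finite ?k" by (rule finite_subset[of _ "Pow {..<m}"]) auto
    moreover have "?k \<subseteq> Collect finite" using finite_subset[OF _ finite_lessThan] by auto
    moreover have "h = (\<lambda>y. y \<inter> {..<m} \<in> ?k)" using m by auto
    ultimately show ?thesis by (intro image_eqI[of _ _ "(m, ?k)"]) auto
  qed
  then have "cylinder_functions \<subseteq> (\<lambda>(m, K) y. y \<inter> {..<m} \<in> K) ` (UNIV \<times> ?K)" by blast
  moreover have "countable ?K"
    by (rule countable_Collect_finite_subset[OF countable_Collect_finite])
  then have "countable ((\<lambda>(m, K) y. y \<inter> {..<m} \<in> K) ` ((UNIV :: nat set) \<times> ?K))"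
    by (intro countable_image countable_SIGMA) simp_all
  ultimately show ?thesis by (rule countable_subset)
qed

text \<open>Finitely many distinct sets already differ below some \<open>m\<close>. This is density
  of the cylinder functions for pointwise convergence.\<close>

lemma cylinder_functions_interpolate:
  assumes "finite F"
  obtains h where "h \<in> cylinder_functions" "\<And>y. y \<in> F \<Longrightarrow> h y = \<phi> y"
proof -
  have "\<exists>c. y \<noteq> z \<longrightarrow> (c \<in> y \<longleftrightarrow> c \<notin> z)" for y z :: "nat set"
    by blast
  then obtain d :: "nat set \<Rightarrow> nat set \<Rightarrow> nat"
    where d: "\<And>y z. y \<noteq> z \<Longrightarrow> (d y z \<in> y \<longleftrightarrow> d y z \<notin> z)" by metis
  define m where "m = Suc (Max (insert 0 (case_prod d ` (F \<times> F))))"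
  have dm: "d y z < m" if "y \<in> F" "z \<in> F" for y z
  proof -
    have "finite (case_prod d ` (F \<times> F))" using assms by simp
    moreover have "d y z \<in> case_prod d ` (F \<times> F)" using that by force
    ultimately show ?thesis unfolding m_def less_Suc_eq_le by (intro Max_ge) auto
  qed
  have inj: "y = z" if "y \<in> F" "z \<in> F" "y \<inter> {..<m} = z \<inter> {..<m}" for y z
    using d[of y z] dm[OF that(1,2)] that(3) by (metis IntI IntD1 lessThan_iff)
  define h where "h y \<longleftrightarrow> (\<exists>z\<in>F. z \<inter> {..<m} = y \<inter> {..<m} \<and> \<phi> z)" for y
  show ?thesis
  proof (rule that[of h])
    show "h \<in> cylinder_functions" by (rule cylinder_functionsI[of m]) (simp add: h_def)
    show "h y = \<phi> y" if "y \<in> F" for y unfolding h_def using inj that by blast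
  qed
qed

text \<open>The Galvin--Miller step. Martin's Axiom gives a sequence \<open>V\<close> in
  \<open>\<U>\<close> that is eventually false at each point of \<open>\<T>\<close> and each finite
  set. The natural numbers are cut into blocks, each with a member of \<open>V\<close> that is false
  at every set missing the block. A new point that misses every second block extends the convergence
  to all sets almost contained in it.\<close>

lemma MA_tower_step:
  assumes MA: "martins_axiom TYPE(real)" and small: "\<T> \<prec> (UNIV :: real set)"
    and inf: "\<And>x. x \<in> \<T> \<Longrightarrow> infinite x"
    and ch: "\<And>x y. x \<in> \<T> \<Longrightarrow> y \<in> \<T> \<Longrightarrow> almost_subset x y \<or> almost_subset y x"
    and U: "\<U> \<subseteq> cylinder_functions"
    and cover: "\<And>F. finite F \<Longrightarrow> F \<subseteq> \<T> \<union> Collect finite \<Longrightarrow> \<exists>h\<in>\<U>. \<forall>y\<in>F. \<not> h y"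
  shows "\<exists>x. infinite x \<and> (\<forall>y\<in>\<T>. almost_subset x y \<and> x \<noteq> y) \<and>
    (\<exists>u. range u \<subseteq> \<U> \<and> (\<forall>y. y \<in> \<T> \<or> almost_subset y x \<longrightarrow> eventually (\<lambda>n. \<not> u n y) sequentially))"
proof -
  obtain p where p: "infinite p" "\<And>x. x \<in> \<T> \<Longrightarrow> almost_subset p x"
    using MA_pseudo_intersection[OF MA small] inf ch by metis
  have small': "\<T> \<union> Collect finite \<prec> (UNIV :: real set)"
    by (intro Un_lesspoll_real small countable_imp_lesspoll_real countable_Collect_finite)
  have "countable \<U>" using U countable_cylinder_functions countable_subset by blast
  then have "\<exists>V. range V \<subseteq> \<U> \<and> (\<forall>y\<in>\<T> \<union> Collect finite. eventually (\<lambda>n. \<not> V n y) sequentially)"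
    by (rule MA_eventually_countable[OF MA _ small' cover])
  then obtain V where V: "range V \<subseteq> \<U>"
    "\<And>y. y \<in> \<T> \<union> Collect finite \<Longrightarrow> eventually (\<lambda>n. \<not> V n y) sequentially"
    by blast
  \<comment> \<open>A block opened at \<open>m\<close> is closed at \<open>m'\<close>;
    \<open>j\<close> picks a member of \<open>V\<close> that is false at all subsets of
    \<open>{..<m}\<close> and sees only coordinates below \<open>m'\<close>. The block must meet
    \<open>p\<close> so that \<open>x\<close> can be infinite, and \<open>n \<le> j\<close>
    preserves the convergence of \<open>V\<close> on \<open>\<T>\<close>.\<close>
  define Q where "Q m n m' j \<longleftrightarrow> m < m' \<and> n \<le> j \<and> (\<forall>s\<subseteq>{..<m}. \<not> V j s) \<and>
      (\<forall>y y'. y \<inter> {..<m'} = y' \<inter> {..<m'} \<longrightarrow> V j y = V j y') \<and> p \<inter> {m..<m'} \<noteq> {}" for m n m' j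
  have "\<exists>m' j. Q m n m' j" for m n
  proof -
    \<comment> \<open>There are finitely many subsets of \<open>{..<m}\<close>, all finite, so
      convergence of \<open>V\<close> at finite sets handles them simultaneously.\<close>
    have "eventually (\<lambda>j. \<forall>s\<in>Pow {..<m}. \<not> V j s) sequentially"
      by (rule eventually_ball_finite) (auto intro!: V(2) intro: finite_subset)
    then have "eventually (\<lambda>j. n \<le> j \<and> (\<forall>s\<in>Pow {..<m}. \<not> V j s)) sequentially"
      by (intro eventually_conj eventually_ge_at_top)
    then obtain j where j: "n \<le> j" "\<And>s. s \<subseteq> {..<m} \<Longrightarrow> \<not> V j s"
      by (auto simp: eventually_sequentially)
    have "V j \<in> cylinder_functions" using V(1) U by blast
    then obtain k where k: "\<And>y y'. y \<inter> {..<k} = y' \<inter> {..<k} \<Longrightarrow> V j y = V j y'"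
      by (rule cylinder_functionsE) blast
    obtain q where q: "m < q" "q \<in> p" using p(1) unfolding infinite_nat_iff_unbounded by blast
    have V': "V j y = V j y'" if "y \<inter> {..<Suc (max k q)} = y' \<inter> {..<Suc (max k q)}" for y y'
      by (rule k, rule Int_lessThan_eq_mono[OF that]) simp
    have "q \<in> p \<inter> {m..<Suc (max k q)}" using q by auto
    then have "p \<inter> {m..<Suc (max k q)} \<noteq> {}" by blast
    moreover have "m < Suc (max k q)" using q(1) by linarith
    ultimately have "Q m n (Suc (max k q)) j"
      unfolding Q_def by (intro conjI allI impI) (rule j V' | assumption)+
    then show ?thesis by blast
  qed
  then obtain M J where Q: "\<And>m n. Q m n (M m n) (J m n)" by metis
  have MJ: "m < M m n" "n \<le> J m n" "s \<subseteq> {..<m} \<Longrightarrow> \<not> V (J m n) s"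
    "y \<inter> {..<M m n} = y' \<inter> {..<M m n} \<Longrightarrow> V (J m n) y = V (J m n) y'"
    "p \<inter> {m..<M m n} \<noteq> {}" for m n s y y'
    using Q[of m n] unfolding Q_def by blast+
  \<comment> \<open>The block boundaries: each block starts where the previous one ends.\<close>
  define \<mu> where "\<mu> = rec_nat 0 (\<lambda>n m. M m n)"
  have \<mu>_Suc: "\<mu> (Suc n) = M (\<mu> n) n" for n by (simp add: \<mu>_def)
  have \<mu>: "strict_mono \<mu>" unfolding strict_mono_Suc_iff by (simp add: \<mu>_Suc MJ(1))
  define B where "B n = {\<mu> n..<\<mu> (Suc n)}" for n
  have pB: "p \<inter> B n \<noteq> {}" for n unfolding B_def \<mu>_Suc by (rule MJ(5))
  have Bless: "c \<notin> B j" if "c \<in> B i" "i < j" for c i j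
    using that strict_mono_less_eq[OF \<mu>, of "Suc i" j] by (simp add: B_def)
  have Bdisj: "i = j" if "c \<in> B i" "c \<in> B j" for c i j
    using Bless[of c i j] Bless[of c j i] that by (meson linorder_less_linear)
  have Bge: "n \<le> c" if "c \<in> B n" for c n
    using that strict_mono_imp_increasing[OF \<mu>, of n] by (auto simp: B_def)
  define u where "u n = V (J (\<mu> n) n)" for n
  \<comment> \<open>If \<open>y\<close> misses the block \<open>B n\<close>, then \<open>u n\<close> cannot distinguish it from \<open>y \<inter> {..<\<mu> n}\<close>.
    The set \<open>x\<close> below misses all odd blocks, so this applies eventually to every \<open>y\<close> almost
    contained in \<open>x\<close>.\<close>
  have uB: "\<not> u n y" if "y \<inter> B n = {}" for n y
  proof -
    have "y \<inter> {..<\<mu> (Suc n)} = (y \<inter> {..<\<mu> n}) \<inter> {..<\<mu> (Suc n)}"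
      using that strict_mono_less[OF \<mu>, of n "Suc n"] by (auto simp: B_def disjoint_iff not_less)
    then have "u n y = u n (y \<inter> {..<\<mu> n})" unfolding u_def \<mu>_Suc by (rule MJ(4))
    then show ?thesis using MJ(3)[of "y \<inter> {..<\<mu> n}" "\<mu> n" n] by (simp add: u_def)
  qed
  define x where "x = p \<inter> (\<Union>n. B (2 * n))"
  have xodd: "c \<notin> x" if "c \<in> B (2 * n + 1)" for c n
  proof
    assume "c \<in> x"
    then obtain k where "c \<in> B (2 * k)" by (auto simp: x_def)
    then have "2 * k = 2 * n + 1" by (rule Bdisj) (rule that)
    then show False by presburger
  qed
  have many: "infinite (p \<inter> (\<Union>n. B (f n)))" if "strict_mono f" for f :: "nat \<Rightarrow> nat"
    unfolding infinite_nat_iff_unbounded_le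
  proof
    fix k
    obtain c where c: "c \<in> p \<inter> B (f k)" using pB by blast
    then have "k \<le> c" using Bge[of c "f k"] strict_mono_imp_increasing[OF that, of k] by simp
    then show "\<exists>n\<ge>k. n \<in> p \<inter> (\<Union>n. B (f n))" using c by blast
  qed
  have x_inf: "infinite x" unfolding x_def by (rule many) (simp add: strict_mono_def)
  \<comment> \<open>The points of \<open>p\<close> in odd blocks make \<open>x\<close> differ from
    each \<open>y\<close> in \<open>\<T>\<close>, because \<open>p\<close> is almost contained in
    \<open>y\<close>. This yields injectivity of the tower.\<close>
  have px: "infinite (p - x)"
  proof -
    have "p \<inter> (\<Union>n. B (2 * n + 1)) \<subseteq> p - x"
      using xodd by auto
    moreover have "infinite (p \<inter> (\<Union>n. B (2 * n + 1)))" by (rule many) (simp add: strict_mono_def)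
    ultimately show ?thesis using finite_subset by blast
  qed
  have "almost_subset x y \<and> x \<noteq> y" if "y \<in> \<T>" for y
  proof
    have "x \<subseteq> p" by (auto simp: x_def)
    then show "almost_subset x y" using p(2)[OF that] unfolding almost_subset_def
      by (meson Diff_mono finite_subset order_refl)
    show "x \<noteq> y" using p(2)[OF that] px unfolding almost_subset_def by blast
  qed
  moreover have "range (\<lambda>n. u (2 * n + 1)) \<subseteq> \<U>" using V(1) by (auto simp: u_def)
  moreover have "eventually (\<lambda>n. \<not> u (2 * n + 1) y) sequentially" if y: "y \<in> \<T> \<or> almost_subset y x" for y
    using y
  proof
    assume "y \<in> \<T>"
    then obtain N where N: "\<And>n. n \<ge> N \<Longrightarrow> \<not> V n y"
      using V(2)[of y] by (auto simp: eventually_sequentially)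
    have "\<not> u (2 * n + 1) y" if "n \<ge> N" for n
      unfolding u_def by (rule N) (use MJ(2)[of "2 * n + 1" "\<mu> (2 * n + 1)"] that in linarith)
    then show ?thesis by (auto simp: eventually_sequentially)
  next
    assume "almost_subset y x"
    then obtain N where N: "y - x \<subseteq> {..<N}"
      unfolding almost_subset_def by (meson finite_nat_iff_bounded)
    have "\<not> u (2 * n + 1) y" if "n \<ge> N" for n
    proof (rule uB, rule ccontr)
      assume "y \<inter> B (2 * n + 1) \<noteq> {}"
      then obtain c where c: "c \<in> y" "c \<in> B (2 * n + 1)" by blast
      then have "c < N" using N xodd[of c n] by auto
      then show False using Bge[OF c(2)] that by linarith
    qed
    then show ?thesis by (auto simp: eventually_sequentially)
  qed
  ultimately show ?thesis using x_inf
    by (intro exI[of _ x] conjI exI[of _ "\<lambda>n. u (2 * n + 1)"]) auto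
qed

section \<open>Coding by real numbers and the recursion along the continuum\<close>

lemma countable_imp_real_enumerates_subsets:
  assumes "countable C"
  shows "\<exists>E :: real \<Rightarrow> 'a set. \<forall>S\<subseteq>C. S \<in> range E"
proof -
  obtain b :: "real \<Rightarrow> nat set" where b: "bij b"
    using nat_sets_eqpoll_reals eqpoll_sym unfolding eqpoll_def by blast
  let ?E = "\<lambda>a. {c \<in> C. to_nat_on C c \<in> b a}"
  have "S \<in> range ?E" if S: "S \<subseteq> C" for S
  proof -
    obtain a where a: "to_nat_on C ` S = b a" using b by (meson bij_pointE)
    have "S = {c \<in> C. to_nat_on C c \<in> to_nat_on C ` S}"
      using S inj_on_image_mem_iff[OF inj_on_to_nat_on[OF assms] _ S] by blast
    then show ?thesis unfolding a by blast
  qed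
  then show ?thesis by blast
qed

text \<open>A sequence is coded by its graph, a subset of \<open>UNIV \<times> C\<close>, and the
  choice operator reads the values back.\<close>

lemma countable_imp_real_enumerates_sequences:
  assumes "countable C"
  shows "\<exists>E :: real \<Rightarrow> nat \<Rightarrow> 'a. \<forall>s. range s \<subseteq> C \<longrightarrow> s \<in> range E"
proof -
  have "countable ((UNIV :: nat set) \<times> C)" using assms by (intro countable_SIGMA) simp_all
  then obtain E :: "real \<Rightarrow> (nat \<times> 'a) set" where E: "\<forall>S\<subseteq>UNIV \<times> C. S \<in> range E"
    using exE[OF countable_imp_real_enumerates_subsets] by blast
  let ?E = "\<lambda>a n. SOME c. (n, c) \<in> E a"
  have "s \<in> range ?E" if s: "range s \<subseteq> C" for s
  proof -
    have "{(n, s n) | n. True} \<subseteq> UNIV \<times> C" using s by blast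
    then have "{(n, s n) | n. True} \<in> range E" by (rule E[rule_format])
    then obtain a where a: "{(n, s n) | n. True} = E a" by (rule rangeE)
    have "s = ?E a" unfolding a[symmetric] by auto
    then show ?thesis by blast
  qed
  then show ?thesis by blast
qed

text \<open>In the terminology of selection principles, \<^term>\<open>range x \<union> Collect finite\<close> is a
  \<open>\<gamma>\<close>-set of size continuum; a cylinder function stands for the clopen set of its zeros.\<close>

theorem MA_gamma_set:
  assumes MA: "martins_axiom TYPE(real)"
  shows "\<exists>x :: real \<Rightarrow> nat set. inj x \<and> (\<forall>\<U>\<subseteq>cylinder_functions.
    (\<forall>F. finite F \<and> F \<subseteq> range x \<union> Collect finite \<longrightarrow> (\<exists>h\<in>\<U>. \<forall>y\<in>F. \<not> h y)) \<longrightarrow>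
    (\<exists>u. range u \<subseteq> \<U> \<and> (\<forall>y\<in>range x \<union> Collect finite. eventually (\<lambda>n. \<not> u n y) sequentially)))"
proof -
  \<comment> \<open>The zero sets of members of \<open>\<U>\<close> form an omega-cover of
    \<open>Y\<close>, with \<open>Y\<close> itself allowed as a zero set.\<close>
  define covers where "covers \<U> Y \<longleftrightarrow> (\<forall>F. finite F \<and> F \<subseteq> Y \<longrightarrow> (\<exists>h\<in>\<U>. \<forall>y\<in>F. \<not> h y))"
    for \<U> :: "(nat set \<Rightarrow> bool) set" and Y
  obtain E :: "real \<Rightarrow> (nat set \<Rightarrow> bool) set" where E: "\<And>\<U>. \<U> \<subseteq> cylinder_functions \<Longrightarrow> \<U> \<in> range E"
    using countable_imp_real_enumerates_subsets[OF countable_cylinder_functions] by blast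
  \<comment> \<open>A well-order of minimal type: its proper initial segments are smaller than the
    continuum, so Martin's Axiom applies at every stage.\<close>
  define r where "r = card_of (UNIV :: real set)"
  have r: "Card_order r" "Field r = UNIV" and wo: "well_order_on UNIV r"
    unfolding r_def by (rule card_of_Card_order Field_card_of card_of_well_order_on)+
  have wf: "wf (r - Id)" and tot: "total r"
    using wo by (auto simp: well_order_on_def linear_order_on_def partial_order_on_def preorder_on_def)
  define under where "under a = {b. (b, a) \<in> r - Id}" for a
  have small: "f ` under a \<prec> (UNIV :: real set)" for f :: "real \<Rightarrow> nat set" and a
  proof -
    have "under a = underS r a" by (auto simp: under_def underS_def)
    then have "under a \<prec> (UNIV :: real set)"
      using card_of_underS[OF r(1), of a] r(2) by (simp add: lesspoll_iff_ordLess r_def)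
    then show ?thesis by (rule lesspoll_trans1[OF image_lepoll])
  qed
  define P where "P f a x \<longleftrightarrow> infinite x \<and> (\<forall>y\<in>f ` under a. almost_subset x y \<and> x \<noteq> y) \<and>
      (E a \<subseteq> cylinder_functions \<longrightarrow> covers (E a) (f ` under a \<union> Collect finite) \<longrightarrow>
        (\<exists>u. range u \<subseteq> E a \<and>
          (\<forall>y. y \<in> f ` under a \<or> almost_subset y x \<longrightarrow> eventually (\<lambda>n. \<not> u n y) sequentially)))"
    for f :: "real \<Rightarrow> nat set" and a x
  have "\<exists>f. \<forall>a. P f a (f a)"
  proof (rule dependent_wf_choice[OF wf])
    fix f g :: "real \<Rightarrow> nat set" and a x assume "\<And>b. (b, a) \<in> r - Id \<Longrightarrow> f b = g b"
    then have "f ` under a = g ` under a" by (auto simp: under_def)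
    then show "P f a x = P g a x" by (simp add: P_def)
  next
    fix a and f :: "real \<Rightarrow> nat set" assume IH: "\<And>b. (b, a) \<in> r - Id \<Longrightarrow> P f b (f b)"
    \<comment> \<open>When \<open>E a\<close> is not a suitable cover, the singleton of the constant
      \<open>False\<close> replaces it, so one application of the step lemma serves both
      cases.\<close>
    define \<U> where "\<U> = (if E a \<subseteq> cylinder_functions \<and> covers (E a) (f ` under a \<union> Collect finite)
      then E a else {\<lambda>_. False})"
    have "\<exists>x. infinite x \<and> (\<forall>y\<in>f ` under a. almost_subset x y \<and> x \<noteq> y) \<and>
      (\<exists>u. range u \<subseteq> \<U> \<and>
        (\<forall>y. y \<in> f ` under a \<or> almost_subset y x \<longrightarrow> eventually (\<lambda>n. \<not> u n y) sequentially))"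
    proof (rule MA_tower_step[OF MA small])
      show "infinite x" if "x \<in> f ` under a" for x
        using that IH by (auto simp: P_def under_def)
      show "almost_subset x y \<or> almost_subset y x" if xy: "x \<in> f ` under a" "y \<in> f ` under a" for x y
      proof -
        obtain b c where bc: "(b, a) \<in> r - Id" "(c, a) \<in> r - Id" "x = f b" "y = f c"
          using xy by (auto simp: under_def)
        consider "b = c" | "(b, c) \<in> r - Id" | "(c, b) \<in> r - Id"
          using tot by (auto simp: total_on_def)
        then show ?thesis
        proof cases
          case 1 then show ?thesis using bc almost_subset_refl by simp
        next
          case 2 then show ?thesis using IH[OF bc(2)] bc by (simp add: P_def under_def)
        next
          case 3 then show ?thesis using IH[OF bc(1)] bc by (simp add: P_def under_def)
        qed
      qed
      show "\<U> \<subseteq> cylinder_functions" by (simp add: \<U>_def cylinder_functions_False)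
      show "\<exists>h\<in>\<U>. \<forall>y\<in>F. \<not> h y" if "finite F" "F \<subseteq> f ` under a \<union> Collect finite" for F
        using that by (simp add: \<U>_def covers_def)
    qed
    then show "\<exists>x. P f a x"
      unfolding P_def \<U>_def by (elim ex_forward conj_forward) (auto split: if_splits)
  qed
  then obtain x where x: "\<And>a. P x a (x a)" by blast
  have step: "almost_subset (x b) (x a) \<and> x b \<noteq> x a" if "(a, b) \<in> r - Id" for a b
    using x[of b] that by (simp add: P_def under_def)
  have "inj x"
  proof (rule injI, rule ccontr)
    fix a b assume "x a = x b" "a \<noteq> b"
    moreover have "(a, b) \<in> r - Id \<or> (b, a) \<in> r - Id"
      using tot \<open>a \<noteq> b\<close> by (auto simp: total_on_def)
    ultimately show False using step by metis
  qed
  moreover have "\<exists>u. range u \<subseteq> \<U> \<and> (\<forall>y\<in>range x \<union> Collect finite. eventually (\<lambda>n. \<not> u n y) sequentially)"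
    if U: "\<U> \<subseteq> cylinder_functions" and cov: "covers \<U> (range x \<union> Collect finite)" for \<U>
  proof -
    \<comment> \<open>The stage that treated \<open>\<U>\<close> itself.\<close>
    obtain a where a: "\<U> = E a" using E[OF U] by blast
    have "covers (E a) (x ` under a \<union> Collect finite)"
    proof -
      have "x ` under a \<union> Collect finite \<subseteq> range x \<union> Collect finite" by blast
      then show ?thesis using cov unfolding a covers_def by (meson order_trans)
    qed
    then obtain u where u: "range u \<subseteq> \<U>"
      "\<And>y. y \<in> x ` under a \<or> almost_subset y (x a) \<Longrightarrow> eventually (\<lambda>n. \<not> u n y) sequentially"
      using x[of a] U unfolding P_def a by blast
    \<comment> \<open>Points placed before stage \<open>a\<close> were handled there explicitly;
      \<open>x a\<close>, all later points and all finite sets are almost contained in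
      \<open>x a\<close>.\<close>
    have "y \<in> x ` under a \<or> almost_subset y (x a)" if y: "y \<in> range x \<union> Collect finite" for y
    proof (cases "finite y")
      case True then show ?thesis by (simp add: almost_subset_def)
    next
      case False
      then obtain b where b: "y = x b" using y by blast
      consider "b = a" | "(b, a) \<in> r - Id" | "(a, b) \<in> r - Id"
        using tot by (auto simp: total_on_def)
      then show ?thesis
      proof cases
        case 1 then show ?thesis using b almost_subset_refl by simp
      next
        case 2 then show ?thesis using b by (auto simp: under_def)
      next
        case 3 then show ?thesis using b step by blast
      qed
    qed
    then have "\<forall>y\<in>range x \<union> Collect finite. eventually (\<lambda>n. \<not> u n y) sequentially"
      by (intro ballI u(2))
    then show ?thesis using u(1) by (intro exI[of _ u] conjI)
  qed
  ultimately show ?thesis unfolding covers_def by (intro exI[of _ x]) simp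
qed

section \<open>Pointwise convergence of Boolean-valued functions\<close>

definition agree_nbhd :: "'a set \<Rightarrow> ('a \<Rightarrow> 'i \<Rightarrow> bool) \<Rightarrow> 'i set \<Rightarrow> 'a \<Rightarrow> 'a set" where
  "agree_nbhd A d F a = {b \<in> A. \<forall>y\<in>F. d b y = d a y}"

text \<open>The initial topology for the evaluations at points of \<open>X\<close>, with
  \<open>bool\<close> discrete. The decoding \<open>d\<close> is a parameter because group elements
  will be codes in \<open>nat\<close>.\<close>

definition pointwise_topology :: "'a set \<Rightarrow> 'i set \<Rightarrow> ('a \<Rightarrow> 'i \<Rightarrow> bool) \<Rightarrow> 'a topology" where
  "pointwise_topology A X d = topology (\<lambda>U. U \<subseteq> A \<and>
     (\<forall>a\<in>U. \<exists>F. finite F \<and> F \<subseteq> X \<and> agree_nbhd A d F a \<subseteq> U))"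

lemma openin_pointwise_topology:
  "openin (pointwise_topology A X d) U \<longleftrightarrow>
     U \<subseteq> A \<and> (\<forall>a\<in>U. \<exists>F. finite F \<and> F \<subseteq> X \<and> agree_nbhd A d F a \<subseteq> U)"
proof -
  let ?P = "\<lambda>U. U \<subseteq> A \<and> (\<forall>a\<in>U. \<exists>F. finite F \<and> F \<subseteq> X \<and> agree_nbhd A d F a \<subseteq> U)"
  have "istopology ?P"
    unfolding istopology_def
  proof (rule conjI; intro allI impI)
    fix S T assume S: "?P S" and T: "?P T"
    have "\<exists>F. finite F \<and> F \<subseteq> X \<and> agree_nbhd A d F a \<subseteq> S \<inter> T" if a: "a \<in> S \<inter> T" for a
    proof -
      obtain F where F: "finite F" "F \<subseteq> X" "agree_nbhd A d F a \<subseteq> S" using S a by blast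
      obtain F' where F': "finite F'" "F' \<subseteq> X" "agree_nbhd A d F' a \<subseteq> T" using T a by blast
      have "agree_nbhd A d (F \<union> F') a \<subseteq> agree_nbhd A d F a \<inter> agree_nbhd A d F' a"
        by (auto simp: agree_nbhd_def)
      then show ?thesis using F F' by (intro exI[of _ "F \<union> F'"]) auto
    qed
    then show "?P (S \<inter> T)" using S by blast
  next
    fix \<K> assume "\<forall>K\<in>\<K>. ?P K"
    then have K: "K \<subseteq> A" "a \<in> K \<Longrightarrow> \<exists>F. finite F \<and> F \<subseteq> X \<and> agree_nbhd A d F a \<subseteq> K" if "K \<in> \<K>" for K a
      using that by simp_all
    have "\<exists>F. finite F \<and> F \<subseteq> X \<and> agree_nbhd A d F a \<subseteq> \<Union>\<K>" if a: "a \<in> \<Union>\<K>" for a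
    proof -
      obtain K where "K \<in> \<K>" "a \<in> K" using a by blast
      with K(2)[OF this] show ?thesis by blast
    qed
    then show "?P (\<Union>\<K>)" using K(1) by (simp add: Sup_le_iff)
  qed
  then show ?thesis unfolding pointwise_topology_def by (simp add: topology_inverse')
qed

lemma topspace_pointwise_topology: "topspace (pointwise_topology A X d) = A"
proof
  show "topspace (pointwise_topology A X d) \<subseteq> A"
    using openin_topspace[of "pointwise_topology A X d"] unfolding openin_pointwise_topology by blast
  have "openin (pointwise_topology A X d) A"
    unfolding openin_pointwise_topology
    by (auto intro!: exI[of _ "{}"] simp: agree_nbhd_def)
  then show "A \<subseteq> topspace (pointwise_topology A X d)" by (rule openin_subset)
qed

lemma agree_nbhd_self: "a \<in> A \<Longrightarrow> a \<in> agree_nbhd A d F a"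
  by (simp add: agree_nbhd_def)

lemma openin_agree_nbhd:
  assumes "finite F" "F \<subseteq> X"
  shows "openin (pointwise_topology A X d) (agree_nbhd A d F a)"
  unfolding openin_pointwise_topology
proof (intro conjI ballI)
  show "agree_nbhd A d F a \<subseteq> A" by (auto simp: agree_nbhd_def)
  fix b assume "b \<in> agree_nbhd A d F a"
  then have "agree_nbhd A d F b \<subseteq> agree_nbhd A d F a" by (auto simp: agree_nbhd_def)
  then show "\<exists>F'. finite F' \<and> F' \<subseteq> X \<and> agree_nbhd A d F' b \<subseteq> agree_nbhd A d F a"
    using assms by blast
qed

text \<open>Basic neighbourhoods are thus clopen, and their indicators will witness complete
  regularity.\<close>

lemma openin_Diff_agree_nbhd:
  assumes "finite F" "F \<subseteq> X"
  shows "openin (pointwise_topology A X d) (A - agree_nbhd A d F a)"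
  unfolding openin_pointwise_topology
proof (intro conjI ballI)
  fix b assume "b \<in> A - agree_nbhd A d F a"
  then have "agree_nbhd A d F b \<subseteq> A - agree_nbhd A d F a" by (auto simp: agree_nbhd_def)
  then show "\<exists>F'. finite F' \<and> F' \<subseteq> X \<and> agree_nbhd A d F' b \<subseteq> A - agree_nbhd A d F a"
    using assms by blast
qed auto

lemma in_closure_of_pointwise_topology:
  assumes "a \<in> pointwise_topology A X d closure_of B" "finite F" "F \<subseteq> X"
  shows "agree_nbhd A d F a \<inter> B \<noteq> {}"
proof -
  have "a \<in> A" using assms(1) in_closure_of topspace_pointwise_topology by metis
  then show ?thesis
    using assms(1) openin_agree_nbhd[OF assms(2,3), of A d a] agree_nbhd_self[of a A d F]
    unfolding in_closure_of by blast
qed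

lemma limitin_pointwise_topology:
  assumes "\<And>n. s n \<in> A"
  shows "limitin (pointwise_topology A X d) s a sequentially \<longleftrightarrow>
    a \<in> A \<and> (\<forall>y\<in>X. eventually (\<lambda>n. d (s n) y = d a y) sequentially)"
proof (intro iffI conjI ballI)
  assume L: "limitin (pointwise_topology A X d) s a sequentially"
  show a: "a \<in> A" using limitin_topspace[OF L] by (simp add: topspace_pointwise_topology)
  fix y assume "y \<in> X"
  then have "openin (pointwise_topology A X d) (agree_nbhd A d {y} a)"
    by (intro openin_agree_nbhd) auto
  then have "eventually (\<lambda>n. s n \<in> agree_nbhd A d {y} a) sequentially"
    using L agree_nbhd_self[OF a] unfolding limitin_def by blast
  then show "eventually (\<lambda>n. d (s n) y = d a y) sequentially"
    by (rule eventually_mono) (simp add: agree_nbhd_def)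
next
  assume R: "a \<in> A \<and> (\<forall>y\<in>X. eventually (\<lambda>n. d (s n) y = d a y) sequentially)"
  have "eventually (\<lambda>n. s n \<in> U) sequentially" if U: "openin (pointwise_topology A X d) U" "a \<in> U" for U
  proof -
    obtain F where F: "finite F" "F \<subseteq> X" "agree_nbhd A d F a \<subseteq> U"
      using U unfolding openin_pointwise_topology by blast
    have "eventually (\<lambda>n. \<forall>y\<in>F. d (s n) y = d a y) sequentially"
      using R F by (intro eventually_ball_finite) auto
    then show ?thesis
      by (rule eventually_mono) (use F assms in \<open>auto simp: agree_nbhd_def\<close>)
  qed
  then show "limitin (pointwise_topology A X d) s a sequentially"
    using R by (simp add: limitin_def topspace_pointwise_topology)
qed

lemma continuous_map_clopen_indicator:
  assumes "openin Z V" "openin Z (topspace Z - V)"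
  shows "continuous_map Z euclideanreal (\<lambda>b. if b \<in> V then 0 else 1)"
  unfolding continuous_map_def
proof (intro conjI allI impI)
  fix U :: "real set"
  have V: "V \<subseteq> topspace Z" using assms(1) by (rule openin_subset)
  consider "0 \<in> U" "1 \<in> U" | "0 \<in> U" "1 \<notin> U" | "0 \<notin> U" "1 \<in> U" | "0 \<notin> U" "1 \<notin> U" by blast
  then show "openin Z {x \<in> topspace Z. (if x \<in> V then 0 else 1) \<in> U}"
  proof cases
    case 1
    then have "{x \<in> topspace Z. (if x \<in> V then 0 else 1) \<in> U} = topspace Z" by auto
    then show ?thesis by (simp only: openin_topspace)
  next
    case 2
    then have "{x \<in> topspace Z. (if x \<in> V then 0 else 1) \<in> U} = V" using V by auto
    then show ?thesis using assms by (simp only:)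
  next
    case 3
    then have "{x \<in> topspace Z. (if x \<in> V then 0 else 1) \<in> U} = topspace Z - V" by auto
    then show ?thesis using assms by (simp only:)
  next
    case 4
    then have "{x \<in> topspace Z. (if x \<in> V then 0 else 1) \<in> U} = {}" by auto
    then show ?thesis by (simp only: openin_empty)
  qed
qed auto

lemma completely_regular_pointwise_topology: "completely_regular_space (pointwise_topology A X d)"
  unfolding completely_regular_space_def
proof (intro allI impI)
  fix S a
  let ?T = "pointwise_topology A X d"
  assume "closedin ?T S \<and> a \<in> topspace ?T - S"
  then have "openin ?T (A - S)" and a: "a \<in> A" "a \<notin> S" and SA: "S \<subseteq> A"
    by (auto simp: closedin_def topspace_pointwise_topology)
  then obtain F where F: "finite F" "F \<subseteq> X" "agree_nbhd A d F a \<subseteq> A - S"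
    unfolding openin_pointwise_topology by blast
  let ?f = "\<lambda>b. if b \<in> agree_nbhd A d F a then 0 else 1 :: real"
  have "continuous_map ?T euclideanreal ?f"
    by (intro continuous_map_clopen_indicator)
      (use openin_agree_nbhd[OF F(1,2)] openin_Diff_agree_nbhd[OF F(1,2)] in
        \<open>simp_all add: topspace_pointwise_topology\<close>)
  then have "continuous_map ?T (top_of_set {0..1}) ?f"
    by (auto simp: continuous_map_in_subtopology)
  moreover have "?f a = 0" using agree_nbhd_self[OF a(1)] by simp
  moreover have "?f ` S \<subseteq> {1}" using F(3) by auto
  ultimately show "\<exists>f. continuous_map ?T (top_of_set {0..1}) f \<and> f a = 0 \<and> f ` S \<subseteq> {1::real}"
    by blast
qed

lemma Hausdorff_pointwise_topology:
  assumes "\<And>a b. a \<in> A \<Longrightarrow> b \<in> A \<Longrightarrow> (\<And>y. y \<in> X \<Longrightarrow> d a y = d b y) \<Longrightarrow> a = b"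
  shows "Hausdorff_space (pointwise_topology A X d)"
  unfolding Hausdorff_space_def topspace_pointwise_topology
proof (intro allI impI)
  fix a b assume ab: "a \<in> A \<and> b \<in> A \<and> a \<noteq> b"
  then obtain y where y: "y \<in> X" "d a y \<noteq> d b y" using assms by blast
  then have "openin (pointwise_topology A X d) (agree_nbhd A d {y} a)"
    "openin (pointwise_topology A X d) (agree_nbhd A d {y} b)"
    by (auto intro!: openin_agree_nbhd)
  moreover have "disjnt (agree_nbhd A d {y} a) (agree_nbhd A d {y} b)"
    using y(2) by (auto simp: disjnt_iff agree_nbhd_def)
  ultimately show "\<exists>U V. openin (pointwise_topology A X d) U \<and> openin (pointwise_topology A X d) V \<and>
      a \<in> U \<and> b \<in> V \<and> disjnt U V"
    using ab agree_nbhd_self by metis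
qed

text \<open>Compact sets in a countable space of this kind are metrizable, so continuity on them can
  be tested along sequences.\<close>

lemma compact_closure_sequence:
  assumes "countable A"
    and inj: "\<And>a b. a \<in> A \<Longrightarrow> b \<in> A \<Longrightarrow> (\<And>y. y \<in> X \<Longrightarrow> d a y = d b y) \<Longrightarrow> a = b"
    and K: "compactin (pointwise_topology A X d) K" and B: "B \<subseteq> K"
    and a: "a \<in> pointwise_topology A X d closure_of B"
  shows "\<exists>s. range s \<subseteq> B \<and> limitin (pointwise_topology A X d) s a sequentially"
proof -
  let ?T = "pointwise_topology A X d"
  have KA: "K \<subseteq> A" using compactin_subset_topspace[OF K] by (simp add: topspace_pointwise_topology)
  have aA: "a \<in> A" using a in_closure_of topspace_pointwise_topology by metis
  have "\<exists>y. b \<in> A \<and> b \<noteq> a \<longrightarrow> y \<in> X \<and> d b y \<noteq> d a y" for b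
    using inj aA by blast
  then obtain sep where sep: "\<And>b. b \<in> A \<Longrightarrow> b \<noteq> a \<Longrightarrow> sep b \<in> X \<and> d b (sep b) \<noteq> d a (sep b)"
    by metis
  \<comment> \<open>The countably many coordinates in \<open>\<Union>n. F n\<close> separate \<open>a\<close> from all other points, so by
    compactness they determine convergence to \<open>a\<close> inside \<open>K\<close>.\<close>
  define F where "F n = sep ` {b \<in> A - {a}. to_nat_on A b < n}" for n
  have "finite {b \<in> A - {a}. to_nat_on A b < n}" for n
    by (rule inj_on_finite[of "to_nat_on A" _ "{..<n}"])
      (use inj_on_to_nat_on[OF assms(1)] in \<open>auto simp: inj_on_def\<close>)
  then have F: "finite (F n)" "F n \<subseteq> X" for n using sep by (auto simp: F_def)
  have Fmono: "F m \<subseteq> F n" if "m \<le> n" for m n using that by (auto simp: F_def)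
  have "\<exists>c. c \<in> B \<and> c \<in> agree_nbhd A d (F n) a" for n
    using in_closure_of_pointwise_topology[OF a F] by blast
  then obtain s where s: "\<And>n. s n \<in> B" "\<And>n. s n \<in> agree_nbhd A d (F n) a" by metis
  have sA: "s n \<in> A" for n using s(1) B KA by blast
  have "eventually (\<lambda>n. d (s n) y = d a y) sequentially" if y: "y \<in> X" for y
  proof (rule ccontr)
    assume "\<not> eventually (\<lambda>n. d (s n) y = d a y) sequentially"
    then have often: "\<exists>m\<ge>n. d (s m) y \<noteq> d a y" for n by (auto simp: eventually_sequentially)
    \<comment> \<open>Points that agree with \<open>a\<close> on \<open>F n\<close> but not at
      \<open>y\<close>; the double complement displays closedness. By compactness some
      \<open>b\<close> in \<open>K\<close> lies in every \<open>C n\<close>: it differs from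
      \<open>a\<close> but agrees with it on each \<open>F n\<close>.\<close>
    define C where "C n = A - (A - agree_nbhd A d (F n) a) - agree_nbhd A d {y} a" for n
    have "closedin ?T (A - (A - agree_nbhd A d (F n) a))" "closedin ?T (A - agree_nbhd A d {y} a)" for n
      using openin_Diff_agree_nbhd[OF F, of A d n a] openin_agree_nbhd[of "{y}" X A d a] y
      by (metis closedin_def closedin_diff closedin_topspace topspace_pointwise_topology,
          metis closedin_diff closedin_topspace empty_subsetI finite.emptyI finite.insertI
            insert_subset topspace_pointwise_topology)
    then have "closedin ?T ((A - (A - agree_nbhd A d (F n) a)) \<inter> (A - agree_nbhd A d {y} a))" for n
      by blast
    moreover have "C n = (A - (A - agree_nbhd A d (F n) a)) \<inter> (A - agree_nbhd A d {y} a)" for n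
      by (auto simp: C_def)
    ultimately have Ccl: "closedin ?T (C n)" for n by simp
    have Cmono: "C n \<subseteq> C m" if "m \<le> n" for m n
      using Fmono[OF that] by (auto simp: C_def agree_nbhd_def)
    have Cs: "\<exists>m. s m \<in> C n" for n
    proof -
      obtain m where m: "m \<ge> n" "d (s m) y \<noteq> d a y" using often by blast
      have "s m \<in> C m" using s(2)[of m] sA m(2) by (auto simp: C_def agree_nbhd_def)
      then show ?thesis using Cmono[OF m(1)] by blast
    qed
    have "K \<inter> \<Inter>(range C) \<noteq> {}"
    proof -
      have "K \<inter> \<Inter>\<F> \<noteq> {}" if fin: "finite \<F>" "\<F> \<subseteq> range C" for \<F>
      proof -
        obtain N where N: "finite N" "\<F> = C ` N" using finite_subset_image[OF fin] by blast
        obtain m where m: "s m \<in> C (Max (insert 0 N))" using Cs by blast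
        have "s m \<in> C n" if "n \<in> N" for n
          using Cmono[of n "Max (insert 0 N)"] N(1) that m by auto
        moreover have "s m \<in> K" using s(1) B by blast
        ultimately show ?thesis using N(2) by blast
      qed
      moreover have "\<forall>C'\<in>range C. closedin ?T C'" using Ccl by blast
      ultimately show ?thesis
        using K[unfolded compactin_fip, THEN conjunct2, rule_format, of "range C"] by blast
    qed
    then obtain b where b: "b \<in> K" "\<And>n. b \<in> C n" by blast
    have bA: "b \<in> A" using b(1) KA by blast
    have "b \<noteq> a" using b(2)[of 0] agree_nbhd_self[OF aA] by (auto simp: C_def)
    \<comment> \<open>The bound in \<open>F n\<close> is strict, hence the successor of the code of
      \<open>b\<close>.\<close>
    then have "sep b \<in> F (Suc (to_nat_on A b))" using bA by (auto simp: F_def)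
    then have "d b (sep b) = d a (sep b)"
      using b(2)[of "Suc (to_nat_on A b)"] by (auto simp: C_def agree_nbhd_def)
    then show False using sep[OF bA \<open>b \<noteq> a\<close>] by blast
  qed
  then have "limitin ?T s a sequentially" using limitin_pointwise_topology[of s A X d a] sA aA by blast
  then show ?thesis using s(1) by blast
qed

section \<open>The group\<close>

definition fun_xor :: "('a \<Rightarrow> bool) \<Rightarrow> ('a \<Rightarrow> bool) \<Rightarrow> 'a \<Rightarrow> bool" where
  "fun_xor \<phi> \<psi> = (\<lambda>y. \<phi> y \<noteq> \<psi> y)"

lemma fun_xor_assoc: "fun_xor (fun_xor \<phi> \<psi>) \<theta> = fun_xor \<phi> (fun_xor \<psi> \<theta>)"
  and fun_xor_self: "fun_xor \<phi> \<phi> = (\<lambda>_. False)"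
  and fun_xor_False: "fun_xor (\<lambda>_. False) \<phi> = \<phi>"
  and fun_xor_cancel: "fun_xor \<phi> (fun_xor \<phi> \<psi>) = \<psi>"
  by (auto simp: fun_xor_def)

text \<open>Finite sets are dense in the Cantor space. They are added to the tower so that a
  cylinder function is determined by its values there.\<close>

lemma cylinder_functions_eq_False:
  assumes "h \<in> cylinder_functions" "\<And>y. finite y \<Longrightarrow> \<not> h y"
  shows "h = (\<lambda>_. False)"
proof
  fix y
  obtain m where "h y = h (y \<inter> {..<m})" using assms(1) by (auto simp: cylinder_functions_def)
  then show "h y = False" using assms(2)[of "y \<inter> {..<m}"] by simp
qed

text \<open>Isolates what the group construction takes from Martin's Axiom. For constant sequences,
  \<open>not_limit\<close> says that no cylinder function agrees with \<open>g\<close> on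
  \<open>X\<close>.\<close>

locale gamma_family =
  fixes X :: "nat set set" and g :: "nat set \<Rightarrow> bool"
  assumes finite_in: "finite y \<Longrightarrow> y \<in> X"
    and gamma: "\<U> \<subseteq> cylinder_functions \<Longrightarrow> (\<And>F. finite F \<Longrightarrow> F \<subseteq> X \<Longrightarrow> \<exists>h\<in>\<U>. \<forall>y\<in>F. \<not> h y) \<Longrightarrow>
      \<exists>u. range u \<subseteq> \<U> \<and> (\<forall>y\<in>X. eventually (\<lambda>n. \<not> u n y) sequentially)"
    and not_limit: "range s \<subseteq> cylinder_functions \<Longrightarrow>
      \<not> (\<forall>y\<in>X. eventually (\<lambda>n. s n y = g y) sequentially)"
begin

text \<open>The subgroup generated by the cylinder functions and \<open>g\<close>. Adding
  \<open>g\<close> is an involution, so the second alternative describes the coset of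
  \<open>g\<close>.\<close>

definition funs :: "(nat set \<Rightarrow> bool) set" where
  "funs = {\<phi>. \<phi> \<in> cylinder_functions \<or> fun_xor g \<phi> \<in> cylinder_functions}"

abbreviation dec :: "nat \<Rightarrow> nat set \<Rightarrow> bool" where
  "dec \<equiv> from_nat_into funs"

abbreviation enc :: "(nat set \<Rightarrow> bool) \<Rightarrow> nat" where
  "enc \<equiv> to_nat_on funs"

definition grp :: "nat monoid" where
  "grp = \<lparr>carrier = enc ` funs, mult = (\<lambda>a b. enc (fun_xor (dec a) (dec b))), one = enc (\<lambda>_. False)\<rparr>"

abbreviation "A \<equiv> enc ` funs"

abbreviation "T \<equiv> pointwise_topology A X dec"

lemma cylinder_xor:
  "h \<in> cylinder_functions \<Longrightarrow> k \<in> cylinder_functions \<Longrightarrow> fun_xor h k \<in> cylinder_functions"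
  unfolding fun_xor_def by (rule cylinder_functions_xor)

lemma cylinder_funs: "h \<in> cylinder_functions \<Longrightarrow> h \<in> funs"
  by (simp add: funs_def)

lemma False_funs: "(\<lambda>_. False) \<in> funs"
  by (rule cylinder_funs[OF cylinder_functions_False])

lemma g_xor_funs:
  assumes "h \<in> cylinder_functions"
  shows "fun_xor g h \<in> funs"
  using assms unfolding funs_def by (simp add: fun_xor_cancel)

lemma fun_xor_g:
  "fun_xor g (fun_xor \<phi> \<psi>) = fun_xor (fun_xor g \<phi>) \<psi>"
  "fun_xor g (fun_xor \<phi> \<psi>) = fun_xor \<phi> (fun_xor g \<psi>)"
  "fun_xor (fun_xor g \<phi>) (fun_xor g \<psi>) = fun_xor \<phi> \<psi>"
  by (auto simp: fun_xor_def)

lemma xor_funs: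
  assumes "\<phi> \<in> funs" "\<psi> \<in> funs"
  shows "fun_xor \<phi> \<psi> \<in> funs"
  using assms cylinder_xor fun_xor_g[of \<phi> \<psi>] unfolding funs_def by (smt (verit) mem_Collect_eq)

lemma countable_funs: "countable funs"
proof -
  have "funs \<subseteq> cylinder_functions \<union> fun_xor g ` cylinder_functions"
  proof
    fix \<phi> assume "\<phi> \<in> funs"
    then show "\<phi> \<in> cylinder_functions \<union> fun_xor g ` cylinder_functions"
      unfolding funs_def using fun_xor_cancel[of g \<phi>] by (metis (lifting) Un_iff imageI mem_Collect_eq)
  qed
  moreover have "countable (cylinder_functions \<union> fun_xor g ` cylinder_functions)"
    using countable_cylinder_functions by simp
  ultimately show ?thesis by (rule countable_subset)
qed

lemma dec_enc: "\<phi> \<in> funs \<Longrightarrow> dec (enc \<phi>) = \<phi>"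
  by (rule from_nat_into_to_nat_on[OF countable_funs])

lemma dec_funs: "a \<in> A \<Longrightarrow> dec a \<in> funs"
  by (auto simp: dec_enc)

lemma enc_dec: "a \<in> A \<Longrightarrow> enc (dec a) = a"
  by (auto simp: dec_enc)

lemma not_g_on_X:
  assumes "h \<in> cylinder_functions"
  obtains y where "y \<in> X" "h y \<noteq> g y"
  using not_limit[of "\<lambda>_. h"] assms by auto

text \<open>The difference of the two functions vanishes on \<open>X\<close>. It is not in the coset
  of \<open>g\<close>, since adding \<open>g\<close> would give a cylinder function equal to
  \<open>g\<close> on \<open>X\<close>. So it is a cylinder function vanishing at all finite sets,
  hence zero. This yields the Hausdorff property.\<close>

lemma dec_inj:
  assumes a: "a \<in> A" "b \<in> A" and eq: "\<And>y. y \<in> X \<Longrightarrow> dec a y = dec b y"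
  shows "a = b"
proof -
  let ?t = "fun_xor (dec a) (dec b)"
  have t: "\<not> ?t y" if "y \<in> X" for y using eq[OF that] by (simp add: fun_xor_def)
  have "?t \<in> funs" using a dec_funs xor_funs by blast
  moreover have "fun_xor g ?t \<notin> cylinder_functions"
  proof
    assume "fun_xor g ?t \<in> cylinder_functions"
    then obtain y where "y \<in> X" "fun_xor g ?t y \<noteq> g y" by (rule not_g_on_X)
    then show False using t by (simp add: fun_xor_def)
  qed
  ultimately have "?t \<in> cylinder_functions" by (simp add: funs_def)
  then have "?t = (\<lambda>_. False)" by (rule cylinder_functions_eq_False) (use t finite_in in blast)
  then have "dec a = dec b" by (auto simp: fun_xor_def fun_eq_iff)
  then show ?thesis using enc_dec a by metis
qed

lemma carrier_grp: "carrier grp = A"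
  and mult_grp: "mult grp a b = enc (fun_xor (dec a) (dec b))"
  and one_grp: "one grp = enc (\<lambda>_. False)"
  by (simp_all add: grp_def)

lemma mult_in: "a \<in> A \<Longrightarrow> b \<in> A \<Longrightarrow> mult grp a b \<in> A"
  unfolding mult_grp by (intro imageI xor_funs dec_funs)

lemma dec_mult: "a \<in> A \<Longrightarrow> b \<in> A \<Longrightarrow> dec (mult grp a b) = fun_xor (dec a) (dec b)"
  unfolding mult_grp by (intro dec_enc xor_funs dec_funs)

lemma dec_one: "dec (one grp) = (\<lambda>_. False)"
  unfolding one_grp by (rule dec_enc[OF False_funs])

lemma one_in: "one grp \<in> A"
  unfolding one_grp by (rule imageI[OF False_funs])

lemma mult_self: "a \<in> A \<Longrightarrow> mult grp a a = one grp"
  by (simp add: mult_grp one_grp fun_xor_self)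

lemma group_grp: "group grp"
proof (rule groupI, unfold carrier_grp)
  show "mult grp a b \<in> A" if "a \<in> A" "b \<in> A" for a b using that by (rule mult_in)
  show "one grp \<in> A" by (rule one_in)
  show "mult grp (mult grp a b) c = mult grp a (mult grp b c)" if "a \<in> A" "b \<in> A" "c \<in> A" for a b c
    unfolding mult_grp[of "mult grp a b"] mult_grp[of a "mult grp b c"]
    using that by (simp only: dec_mult fun_xor_assoc)
  show "mult grp (one grp) a = a" if "a \<in> A" for a
    unfolding mult_grp dec_one fun_xor_False using that by (rule enc_dec)
  show "\<exists>b\<in>A. mult grp b a = one grp" if "a \<in> A" for a using mult_self that by blast
qed

lemma boolean_group_grp: "boolean_group grp"
  unfolding boolean_group_def carrier_grp using group_grp mult_self by blast

lemma inv_grp: "a \<in> A \<Longrightarrow> m_inv grp a = a"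
  by (rule group.inv_equality[OF group_grp mult_self]) (simp_all add: carrier_grp)

lemma topological_group_grp: "topological_group grp T"
  unfolding topological_group_def
proof (intro conjI)
  show "group grp" by (rule group_grp)
  show "topspace T = carrier grp" by (simp only: topspace_pointwise_topology carrier_grp)
  show "continuous_map T T (m_inv grp)"
    by (rule continuous_map_eq[OF continuous_map_id]) (simp add: topspace_pointwise_topology inv_grp)
  show "continuous_map (prod_topology T T) T (\<lambda>(x, y). mult grp x y)"
    unfolding continuous_map_def topspace_prod_topology topspace_pointwise_topology
  proof (intro conjI allI impI)
    show "(\<lambda>(x, y). mult grp x y) \<in> A \<times> A \<rightarrow> A" using mult_in by auto
    fix U assume U: "openin T U"
    show "openin (prod_topology T T) {z \<in> A \<times> A. (case z of (x, y) \<Rightarrow> mult grp x y) \<in> U}"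
      unfolding openin_prod_topology_alt
    proof (intro allI impI)
      fix a b assume "(a, b) \<in> {z \<in> A \<times> A. (case z of (x, y) \<Rightarrow> mult grp x y) \<in> U}"
      then have ab: "a \<in> A" "b \<in> A" "mult grp a b \<in> U" by auto
      then obtain F where F: "finite F" "F \<subseteq> X" "agree_nbhd A dec F (mult grp a b) \<subseteq> U"
        using U unfolding openin_pointwise_topology by blast
      \<comment> \<open>Addition is coordinatewise, so the same finite \<open>F\<close> controls
        both factors.\<close>
      let ?N = "agree_nbhd A dec F"
      have "mult grp a' b' \<in> U" if "a' \<in> ?N a" "b' \<in> ?N b" for a' b'
      proof -
        have ab': "a' \<in> A" "b' \<in> A" using that by (auto simp: agree_nbhd_def)
        have "dec (mult grp a' b') y = dec (mult grp a b) y" if "y \<in> F" for y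
          unfolding dec_mult[OF ab'] dec_mult[OF ab(1,2)] fun_xor_def
          using \<open>a' \<in> ?N a\<close> \<open>b' \<in> ?N b\<close> that by (simp add: agree_nbhd_def)
        then have "mult grp a' b' \<in> ?N (mult grp a b)"
          using mult_in[OF ab'] by (simp add: agree_nbhd_def)
        then show ?thesis using F(3) by blast
      qed
      moreover have "?N a \<subseteq> A" "?N b \<subseteq> A" by (auto simp: agree_nbhd_def)
      ultimately have "?N a \<times> ?N b \<subseteq> {z \<in> A \<times> A. (case z of (x, y) \<Rightarrow> mult grp x y) \<in> U}" by auto
      moreover have "openin T (?N a)" "openin T (?N b)" 
        by (rule openin_agree_nbhd[OF F(1,2)])+
      moreover have "a \<in> ?N a" "b \<in> ?N b" by (rule agree_nbhd_self[OF ab(1)] agree_nbhd_self[OF ab(2)])+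
      ultimately show "\<exists>U' V. openin T U' \<and> openin T V \<and> a \<in> U' \<and> b \<in> V \<and>
          U' \<times> V \<subseteq> {z \<in> A \<times> A. (case z of (x, y) \<Rightarrow> mult grp x y) \<in> U}"
        by (intro exI[of _ "?N a"] exI[of _ "?N b"] conjI)
    qed
  qed
qed

lemma Hausdorff_T: "Hausdorff_space T"
  by (rule Hausdorff_pointwise_topology) (rule dec_inj)

lemma tychonoff_T: "tychonoff_space T"
  unfolding tychonoff_space_def by (intro conjI Hausdorff_T completely_regular_pointwise_topology)

text \<open>\<open>gamma\<close> is the Frechet--Urysohn property at zero of the dense subgroup of
  cylinder functions. As \<open>U\<close> is open, density allows \<open>a\<close> to be
  approximated within \<open>U\<close> by translates \<open>a + h\<close> with \<open>h\<close> a
  cylinder function.\<close>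

lemma kappa_frechet_urysohn_T: "kappa_frechet_urysohn T"
  unfolding kappa_frechet_urysohn_def
proof (intro conjI allI impI tychonoff_T)
  fix U a assume "openin T U \<and> a \<in> T closure_of U"
  then have U: "openin T U" and cl: "a \<in> T closure_of U" by auto
  have a: "a \<in> A" using cl in_closure_of topspace_pointwise_topology by metis
  define \<U> where "\<U> = {h \<in> cylinder_functions. enc (fun_xor (dec a) h) \<in> U}"
  have "\<exists>u. range u \<subseteq> \<U> \<and> (\<forall>y\<in>X. eventually (\<lambda>n. \<not> u n y) sequentially)"
  proof (rule gamma)
    show "\<U> \<subseteq> cylinder_functions" by (auto simp: \<U>_def)
    fix F assume F: "finite F" "F \<subseteq> X"
    obtain b where b: "b \<in> agree_nbhd A dec F a" "b \<in> U"
      using in_closure_of_pointwise_topology[OF cl F] by blast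
    obtain F' where F': "finite F'" "F' \<subseteq> X" "agree_nbhd A dec F' b \<subseteq> U"
      using U b(2) unfolding openin_pointwise_topology by blast
    \<comment> \<open>On \<open>F'\<close> the translate \<open>a + h\<close> copies
      \<open>b\<close>, which keeps it in \<open>U\<close>; on \<open>F\<close> the function
      \<open>h\<close> is zero because \<open>a\<close> and \<open>b\<close> agree there.\<close>
    obtain h where h: "h \<in> cylinder_functions" "\<And>y. y \<in> F \<union> F' \<Longrightarrow> h y = fun_xor (dec a) (dec b) y"
      using cylinder_functions_interpolate[of "F \<union> F'"] F(1) F'(1) by blast
    have ah: "fun_xor (dec a) h \<in> funs" using dec_funs[OF a] cylinder_funs[OF h(1)] by (rule xor_funs)
    have "fun_xor (dec a) h y = dec b y" if "y \<in> F \<union> F'" for y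
      using h(2)[OF that] by (auto simp: fun_xor_def)
    then have "enc (fun_xor (dec a) h) \<in> agree_nbhd A dec F' b"
      using ah by (simp add: agree_nbhd_def dec_enc)
    then have "h \<in> \<U>" using F'(3) h(1) by (auto simp: \<U>_def)
    moreover have "\<not> h y" if "y \<in> F" for y
      using h(2)[of y] that b(1) by (auto simp: fun_xor_def agree_nbhd_def)
    ultimately show "\<exists>h\<in>\<U>. \<forall>y\<in>F. \<not> h y" by blast
  qed
  then obtain u where u: "\<And>n. u n \<in> \<U>" "\<And>y. y \<in> X \<Longrightarrow> eventually (\<lambda>n. \<not> u n y) sequentially"
    by blast
  define s where "s n = enc (fun_xor (dec a) (u n))" for n
  have uf: "fun_xor (dec a) (u n) \<in> funs" for n
    using dec_funs[OF a] cylinder_funs[of "u n"] u(1)[of n] by (auto simp: \<U>_def intro: xor_funs)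
  have sU: "range s \<subseteq> U" using u(1) by (auto simp: s_def \<U>_def)
  have "limitin T s a sequentially"
  proof (subst limitin_pointwise_topology, unfold s_def)
    show "enc (fun_xor (dec a) (u n)) \<in> A" for n using uf by blast
    have "eventually (\<lambda>n. dec (enc (fun_xor (dec a) (u n))) y = dec a y) sequentially" if "y \<in> X" for y
      using u(2)[OF that] by (rule eventually_mono) (unfold dec_enc[OF uf], simp add: fun_xor_def)
    then show "a \<in> A \<and> (\<forall>y\<in>X. eventually (\<lambda>n. dec (enc (fun_xor (dec a) (u n))) y = dec a y) sequentially)"
      using a by blast
  qed
  then show "\<exists>s. range s \<subseteq> U \<and> limitin T s a sequentially" using sU by blast
qed

section \<open>The subgroup of cylinder functions is sequentially clopen but not open\<close>

definition cyl_part :: "nat set" where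
  "cyl_part = {a \<in> A. dec a \<in> cylinder_functions}"

text \<open>If a sequence from one coset converged to a point of the other, the sums
  \<open>g + s n + a\<close> would be cylinder functions converging to \<open>g\<close> on
  \<open>X\<close>.\<close>

lemma cyl_part_sequentially_separated:
  assumes s: "\<And>n. s n \<in> A" and l: "limitin T s a sequentially"
    and opp: "\<And>n. s n \<in> cyl_part \<longleftrightarrow> a \<notin> cyl_part"
  shows False
proof -
  have a: "a \<in> A" and ev: "\<And>y. y \<in> X \<Longrightarrow> eventually (\<lambda>n. dec (s n) y = dec a y) sequentially"
    using l limitin_pointwise_topology[of s A X dec a] s by blast+
  define h where "h n = fun_xor g (fun_xor (dec (s n)) (dec a))" for n
  have "h n \<in> cylinder_functions" for n
  proof (cases "a \<in> cyl_part")
    case True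
    then have "dec a \<in> cylinder_functions" "dec (s n) \<notin> cylinder_functions"
      using opp[of n] s[of n] by (auto simp: cyl_part_def)
    moreover then have "fun_xor g (dec (s n)) \<in> cylinder_functions"
      using dec_funs[OF s] by (auto simp: funs_def)
    ultimately show ?thesis unfolding h_def fun_xor_g(1) using cylinder_xor by blast
  next
    case False
    then have "dec (s n) \<in> cylinder_functions" "dec a \<notin> cylinder_functions"
      using opp[of n] a by (auto simp: cyl_part_def)
    moreover then have "fun_xor g (dec a) \<in> cylinder_functions"
      using dec_funs[OF a] by (auto simp: funs_def)
    ultimately show ?thesis unfolding h_def fun_xor_g(2) using cylinder_xor by blast
  qed
  then have "\<not> (\<forall>y\<in>X. eventually (\<lambda>n. h n y = g y) sequentially)" by (intro not_limit) blast
  moreover have "eventually (\<lambda>n. h n y = g y) sequentially" if "y \<in> X" for y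
    using ev[OF that] by (rule eventually_mono) (simp add: h_def fun_xor_def)
  ultimately show False by blast
qed

lemma k_continuous_cyl_part: "k_continuous T (\<lambda>b. if b \<in> cyl_part then 0 else 1)"
  unfolding k_continuous_def
proof (intro allI impI)
  fix K assume K: "compactin T K"
  have KA: "K \<subseteq> A" using compactin_subset_topspace[OF K] by (simp add: topspace_pointwise_topology)
  \<comment> \<open>To be applied to the traces of both cosets: a point of \<open>K - B\<close> in
    the closure of \<open>B\<close> would be the limit of a sequence from the opposite
    coset.\<close>
  have opn: "openin (subtopology T K) (K - B)"
    if B: "B \<subseteq> K" and sep: "\<And>a b. a \<in> K - B \<Longrightarrow> b \<in> B \<Longrightarrow> b \<in> cyl_part \<longleftrightarrow> a \<notin> cyl_part" for B
  proof -
    have "a \<notin> T closure_of B" if a: "a \<in> K - B" for a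
    proof
      assume "a \<in> T closure_of B"
      then obtain s where s: "range s \<subseteq> B" "limitin T s a sequentially"
        using compact_closure_sequence[OF _ dec_inj K B] countable_funs by blast
      show False
        by (rule cyl_part_sequentially_separated[OF _ s(2)]) (use s(1) B KA sep[OF a] in blast)+
    qed
    then have "K - B = (A - T closure_of B) \<inter> K"
      using closure_of_subset[of B T] B KA by (auto simp: topspace_pointwise_topology)
    moreover have "openin T (A - T closure_of B)"
      using closedin_closure_of[of T B] by (simp add: closedin_def topspace_pointwise_topology)
    ultimately show ?thesis by (auto simp: openin_subtopology)
  qed
  have tK: "topspace (subtopology T K) = K" using KA by (auto simp: topspace_pointwise_topology)
  have "continuous_map (subtopology T K) euclideanreal (\<lambda>b. if b \<in> K \<inter> cyl_part then 0 else 1)"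
  proof (rule continuous_map_clopen_indicator, unfold tK)
    have "openin (subtopology T K) (K - (K - cyl_part))" by (rule opn) auto
    moreover have "K - (K - cyl_part) = K \<inter> cyl_part" by blast
    ultimately show "openin (subtopology T K) (K \<inter> cyl_part)" by simp
    show "openin (subtopology T K) (K - K \<inter> cyl_part)" by (rule opn) auto
  qed
  then show "continuous_map (subtopology T K) euclideanreal (\<lambda>b. if b \<in> cyl_part then 0 else 1)"
    by (rule continuous_map_eq) (simp add: topspace_pointwise_topology)
qed

text \<open>Continuity of the indicator would make the subgroup open, but every neighbourhood of the
  identity meets the coset of \<open>g\<close>.\<close>

lemma not_kR_space_T: "\<not> kR_space T"
proof
  assume "kR_space T"
  then have "continuous_map T euclideanreal (\<lambda>b. if b \<in> cyl_part then 0 else 1)"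
    using k_continuous_cyl_part unfolding kR_space_def by blast
  then have "openin T {b \<in> topspace T. (if b \<in> cyl_part then 0 else 1 :: real) \<in> {..<1}}"
    by (rule openin_continuous_map_preimage) simp
  moreover have "{b \<in> topspace T. (if b \<in> cyl_part then 0 else 1 :: real) \<in> {..<1}} = cyl_part"
    by (auto simp: topspace_pointwise_topology cyl_part_def)
  ultimately have op: "openin T cyl_part" by simp
  have "one grp \<in> cyl_part"
    using one_in by (simp add: cyl_part_def dec_one cylinder_functions_False)
  then obtain F where F: "finite F" "F \<subseteq> X" "agree_nbhd A dec F (one grp) \<subseteq> cyl_part"
    using op unfolding openin_pointwise_topology by blast
  \<comment> \<open>Since \<open>h\<close> imitates \<open>g\<close> on \<open>F\<close>, the sum
    \<open>g + h\<close> vanishes on \<open>F\<close> while lying in the coset of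
    \<open>g\<close>.\<close>
  obtain h where h: "h \<in> cylinder_functions" "\<And>y. y \<in> F \<Longrightarrow> h y = g y"
    using cylinder_functions_interpolate[OF F(1)] by blast
  have gh: "fun_xor g h \<in> funs" using h(1) by (rule g_xor_funs)
  have "enc (fun_xor g h) \<in> agree_nbhd A dec F (one grp)"
    using gh h(2) by (auto simp: agree_nbhd_def dec_enc dec_one fun_xor_def)
  then have "dec (enc (fun_xor g h)) \<in> cylinder_functions" using F(3) unfolding cyl_part_def by blast
  then have "fun_xor g h \<in> cylinder_functions" unfolding dec_enc[OF gh] .
  then have "fun_xor (fun_xor g h) h \<in> cylinder_functions" using h(1) by (rule cylinder_xor)
  moreover have "fun_xor (fun_xor g h) h = g" by (auto simp: fun_xor_def)
  ultimately show False using not_g_on_X[of g] by auto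
qed

end

theorem mainTheorem5:
  assumes "martins_axiom TYPE(real)"
  shows "\<exists>(G :: nat monoid) (X :: nat topology).
           topological_group G X \<and> Hausdorff_space X \<and>
           countable (carrier G) \<and> boolean_group G \<and>
           kappa_frechet_urysohn X \<and> \<not> kR_space X"
proof -
  obtain x :: "real \<Rightarrow> nat set" where x: "inj x" and gamma: "\<forall>\<U>\<subseteq>cylinder_functions.
    (\<forall>F. finite F \<and> F \<subseteq> range x \<union> Collect finite \<longrightarrow> (\<exists>h\<in>\<U>. \<forall>y\<in>F. \<not> h y)) \<longrightarrow>
    (\<exists>u. range u \<subseteq> \<U> \<and> (\<forall>y\<in>range x \<union> Collect finite. eventually (\<lambda>n. \<not> u n y) sequentially))"
    using MA_gamma_set[OF assms] by (elim exE conjE)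
  obtain E :: "real \<Rightarrow> nat \<Rightarrow> nat set \<Rightarrow> bool" where
    E: "\<forall>s. range s \<subseteq> cylinder_functions \<longrightarrow> s \<in> range E"
    using countable_imp_real_enumerates_sequences[OF countable_cylinder_functions] by (elim exE)
  \<comment> \<open>Diagonalisation: at \<open>x a\<close> the value of \<open>g\<close> is true
    exactly when the sequence \<open>E a\<close> is not eventually true there, so \<open>E a\<close>
    does not converge to \<open>g\<close> at \<open>x a\<close>. Injectivity of \<open>x\<close>
    lets \<open>inv_into\<close> recover \<open>a\<close> from the point.\<close>
  define g where "g y \<longleftrightarrow> \<not> eventually (\<lambda>n. E (inv_into UNIV x y) n y) sequentially" for y
  interpret gamma_family "range x \<union> Collect finite" g
  proof
    show "y \<in> range x \<union> Collect finite" if "finite y" for y using that by simp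
    show "\<exists>u. range u \<subseteq> \<U> \<and> (\<forall>y\<in>range x \<union> Collect finite. eventually (\<lambda>n. \<not> u n y) sequentially)"
      if "\<U> \<subseteq> cylinder_functions"
        "\<And>F. finite F \<Longrightarrow> F \<subseteq> range x \<union> Collect finite \<Longrightarrow> \<exists>h\<in>\<U>. \<forall>y\<in>F. \<not> h y" for \<U>
      using gamma that by simp
    show "\<not> (\<forall>y\<in>range x \<union> Collect finite. eventually (\<lambda>n. s n y = g y) sequentially)"
      if s: "range s \<subseteq> cylinder_functions" for s
    proof
      assume lim: "\<forall>y\<in>range x \<union> Collect finite. eventually (\<lambda>n. s n y = g y) sequentially"
      have "s \<in> range E" using E s by simp
      then obtain a where a: "s = E a" by (rule rangeE)
      have ev: "eventually (\<lambda>n. s n (x a) = g (x a)) sequentially" using lim by simp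
      have g: "g (x a) \<longleftrightarrow> \<not> eventually (\<lambda>n. s n (x a)) sequentially"
        unfolding g_def a inv_f_f[OF x] ..
      show False
      proof (cases "g (x a)")
        case True
        then have "eventually (\<lambda>n. s n (x a)) sequentially" using ev by simp
        then show False using g True by simp
      next
        case False
        then have "eventually (\<lambda>n. s n (x a)) sequentially" using g by simp
        with ev have "eventually (\<lambda>n. False) sequentially"
          by eventually_elim (use False in simp)
        then show False by simp
      qed
    qed
  qed
  have "countable (carrier grp)" by (simp add: carrier_grp countable_funs)
  then show ?thesis
    using topological_group_grp Hausdorff_T boolean_group_grp kappa_frechet_urysohn_T not_kR_space_T
    by blast
qed

end
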